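(* Let $(M^8,g,\rho)$ be a $\mathrm{PSU}(3)$-structure of type $\mathcal{W}_1\oplus\dots\oplus\mathcal{W}_5$ with parallel characteristic torsion, i.e. $\nabla^cT^c=0$ and $\nabla^cF^c=0$. Then \begin{align*} dT^c&=\sum_i(e_i\lrcorner T^c)\wedge(e_i\lrcorner T^c)-\sum_i\big((e_i\lrcorner\rho)\lrcorner F^c\big)\wedge(e_i\lrcorner T^c),\\ \delta T^c&=-3\big((\rho\lrcorner F^c)\lrcorner T^c\big)+\sum_{i,j}\big(e_i\lrcorner((e_j\lrcorner\rho)\lrcorner F^c)\big)\wedge(e_i\lrcorner e_j\lrcorner T^c),\\ dF^c&=\sum_i(e_i\lrcorner T^c)\wedge(e_i\lrcorner F^c)-\sum_i\big((e_i\lrcorner\rho)\lrcorner F^c\big)\wedge(e_i\lrcorner F^c),\\ \delta F^c&=-3\big((\rho\lrcorner F^c)\lrcorner F^c\big)+\tfrac12\sum_{i,j}(e_i\lrcorner e_j\lrcorner T^c)\wedge(e_i\lrcorner e_j\lrcorner F^c)+\sum_{i,j}\big(e_i\lrcorner((e_j\lrcorner\rho)\lrcorner F^c)\big)\wedge(e_i\lrcorner e_j\lrcorner F^c). \end{align*}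
   Context: Algebraic setting. $\mathbb{R}^8$ is oriented Euclidean space, identified with its dual; $(e_1,\dots,e_8)$ is an oriented orthonormal basis, $e_{i_1\dots i_j}=e_{i_1}\wedge\dots\wedge e_{i_j}$, $\Lambda^k$ the space of $k$-forms. For $\alpha\in\Lambda^k,\beta\in\Lambda^l$ put $\sigma_0(\alpha,\beta)=\alpha\wedge\beta$ and $\sigma_j(\alpha,\beta)=\sum_{i_1<\dots<i_j}(e_{i_1}\lrcorner\cdots\lrcorner e_{i_j}\lrcorner\alpha)\wedge(e_{i_1}\lrcorner\cdots\lrcorner e_{i_j}\lrcorner\beta)$. For $k\le l$ the contraction is $\alpha\lrcorner\beta=\sigma_k(\alpha,\beta)$; $\ast$ is the Hodge operator. Let $$(\star)\quad\rho=e_{246}-e_{235}-e_{145}-e_{136}+(e_{12}+e_{34}-2e_{56})\wedge e_7+\sqrt3\,(e_{12}-e_{34})\wedge e_8 ,$$ $\mathrm{PSU}(3)\subset\mathrm{SO}(8)$ its isotropy group, $\sigma_+(\alpha)=\sigma_1(\rho,\alpha)$. Modules: $\Lambda^2_8=\sigma_+(\Lambda^1)$, $\Lambda^2_{20}=\{\omega\in\Lambda^2\mid\omega\wedge\ast\rho=0\}$, $\Lambda^3_8=\{\ast(\omega\wedge\rho)\mid\omega\in\Lambda^2_8\}$, $\Lambda^3_{20}=\sigma_+(\Lambda^2_{20})$, $\Lambda^3_{27}=\{T\in\Lambda^3\mid T\wedge\rho=0,\ T\wedge\ast\rho=0\}$, $\Lambda^4_8=\sigma_+(\Lambda^3_8)$,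 $\Lambda^4_{27}=\sigma_+(\Lambda^3_{27})$. With $\mathfrak{so}(8)=\Lambda^2$ one has $\mathfrak{psu}(3)=\Lambda^2_8$; let $\mathfrak m=\Lambda^2_{20}$ be its orthogonal complement and $\mathrm{pr}_{\mathfrak m}$ the projection. Maps: $\Phi_1(X\otimes\omega)=X\wedge\omega$ and $\Phi_2(X\otimes\omega)=(X\lrcorner\rho)\wedge\omega$ on $\mathbb{R}^8\otimes\mathfrak m$; $\Theta_1(T)=-\frac12\sum_i e_i\otimes\mathrm{pr}_{\mathfrak m}(e_i\lrcorner T)$ for $T\in\Lambda^3$; $\Theta_2(F)=-\sum_i e_i\otimes\mathrm{pr}_{\mathfrak m}((e_i\lrcorner\rho)\lrcorner F)$ for $F\in\Lambda^4$. Put $\mathcal{W}_1=\Theta_1(\Lambda^3_8)$, $\mathcal{W}_2=\Theta_1(\Lambda^3_{20})$, $\mathcal{W}_3=\Theta_1(\Lambda^3_{27})$, $\mathcal{W}_4=\Theta_2(\ast\Lambda^4_8)$, $\mathcal{W}_5=\Theta_2(\ast\Lambda^4_{27})$, $\mathcal{W}_6=\mathrm{Ker}(\Phi_1)\cap\mathrm{Ker}(\Phi_2)$; then $\mathbb{R}^8\otimes\mathfrak m=\mathcal{W}_1\oplus\dots\oplus\mathcal{W}_6$. Geometric setting. A $\mathrm{PSU}(3)$-structure $(M^8,g,\rho)$ is an (oriented) Riemannian 8-manifold with a 3-form $\rho$ such that at every point there is an oriented orthonormal frame $(e_1,\dots,e_8)$ (an adapted frame) realizing $(\star)$; the operators $\sigma_j,\sigma_+,\ast$,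 the modules $\Lambda^k_i$ and $\mathfrak m$, the maps $\Phi_1,\Phi_2,\Theta_1,\Theta_2$ and the spaces $\mathcal{W}_1,\dots,\mathcal{W}_6$ are applied pointwise in adapted frames. Let $\Omega^g=(\omega^g_{ij})$, $\omega^g_{ij}=g(\nabla^g e_i,e_j)$, in an adapted frame. The intrinsic torsion is $\Gamma=\mathrm{pr}_{\mathfrak m}(\Omega^g)=\Gamma_1+\dots+\Gamma_6$, $\Gamma_i\in\mathcal{W}_i$. The structure is of type $\mathcal{W}_{i_1}\oplus\dots\oplus\mathcal{W}_{i_j}$ if $\Gamma\in\mathcal{W}_{i_1}\oplus\dots\oplus\mathcal{W}_{i_j}$. The characteristic forms are $T^c\in\Lambda^3_8\oplus\Lambda^3_{20}\oplus\Lambda^3_{27}$ with $\Theta_1(T^c)=\Gamma_1+\Gamma_2+\Gamma_3$ and $F^c\in\ast\Lambda^4_8\oplus\ast\Lambda^4_{27}$ with $\Theta_2(F^c)=\Gamma_4+\Gamma_5$. For a structure of type $\mathcal{W}_1\oplus\dots\oplus\mathcal{W}_5$ the characteristic connection $\nabla^c$ is the metric connection $g(\nabla^c_XY,Z)=g(\nabla^g_XY,Z)+\frac12T^c(X,Y,Z)+((X\lrcorner\rho)\lrcorner F^c)(Y,Z)$ (it satisfies $\nabla^c\rho=0$). $d$ and $\delta=-\sum_ie_i\lrcorner\nabla^g_{e_i}$ are the Riemannian differential and co-differential. *)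

theory Defs
  imports
    "HOL-Analysis.Analysis"
    "HOL-Library.Function_Algebras"
    "HOL-Library.Set_Algebras"
begin

section \<open>Exterior algebra of Euclidean 8-space\<close>

type_synonym vec8 = "real ^ 8"

text \<open>
  Covariant tensors, of all degrees at once, are functions on lists of vectors; a tensor of
  degree \<open>k\<close> vanishes on all lists of length different from \<open>k\<close>.  Addition, sums and \<open>0\<close> are
  the pointwise ones.
\<close>

type_synonym form = "vec8 list \<Rightarrow> real"

definition multilinear_form :: "nat \<Rightarrow> form \<Rightarrow> bool" where
  "multilinear_form k \<alpha> \<longleftrightarrow>
     (\<forall>vs. length vs \<noteq> k \<longrightarrow> \<alpha> vs = 0) \<and>
     (\<forall>vs i. length vs = k \<and> i < k \<longrightarrow> linear (\<lambda>v. \<alpha> (vs[i := v])))"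

definition Lam :: "nat \<Rightarrow> form set" where
  "Lam k = {\<alpha>. multilinear_form k \<alpha> \<and>
     (\<forall>vs i j. i < j \<and> j < length vs \<and> vs ! i = vs ! j \<longrightarrow> \<alpha> vs = 0)}"

definition fscale :: "real \<Rightarrow> form \<Rightarrow> form" (infixr \<open>\<cdot>\<close> 72) where
  "r \<cdot> \<alpha> = (\<lambda>vs. r * \<alpha> vs)"

text \<open>
  The basis is indexed by \<open>1, \<dots>, 8 :: nat\<close>; in the index type \<open>8\<close> the number 8 equals 0, so
  \<open>eb 8\<close> is the coordinate vector with index 0.  The orientation is fixed by the form \<open>vol\<close> below.
\<close>

definition eb :: "nat \<Rightarrow> vec8" where
  "eb i = axis (of_nat i) 1"

definition flat :: "vec8 \<Rightarrow> form" where
  "flat X = (\<lambda>vs. case vs of [v] \<Rightarrow> X \<bullet> v | _ \<Rightarrow> 0)"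

definition shuffle_sign :: "nat set \<Rightarrow> real" where
  "shuffle_sign S = (- 1) ^ card {(a, b). a \<in> S \<and> b \<notin> S \<and> b < a}"

text \<open>
  The sum over all shuffles, normalised so that \<open>(flat X \<and>\<^sub>\<Lambda> flat Y) [v, w]\<close> is
  \<open>(X \<bullet> v) * (Y \<bullet> w) - (X \<bullet> w) * (Y \<bullet> v)\<close>.  Only those \<open>S\<close> contribute whose cardinality is the
  degree of \<open>\<alpha>\<close>.
\<close>

definition wedge :: "form \<Rightarrow> form \<Rightarrow> form" (infixl \<open>\<and>\<^sub>\<Lambda>\<close> 70) where
  "\<alpha> \<and>\<^sub>\<Lambda> \<beta> = (\<lambda>vs. \<Sum>S\<in>Pow {..<length vs}.
     shuffle_sign S * \<alpha> (nths vs S) * \<beta> (nths vs (- S)))"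

definition form_one :: form where
  "form_one = (\<lambda>vs. if vs = [] then 1 else 0)"

definition ew :: "nat list \<Rightarrow> form" where
  "ew is = foldr (\<lambda>i \<alpha>. flat (eb i) \<and>\<^sub>\<Lambda> \<alpha>) is form_one"

definition vol :: form where
  "vol = ew [1, 2, 3, 4, 5, 6, 7, 8]"

definition iprod :: "vec8 \<Rightarrow> form \<Rightarrow> form" (infixr \<open>\<lrcorner>\<close> 75) where
  "X \<lrcorner> \<alpha> = (\<lambda>vs. \<alpha> (X # vs))"

definition iprods :: "nat list \<Rightarrow> form \<Rightarrow> form" where
  "iprods is \<alpha> = foldr (\<lambda>i \<beta>. eb i \<lrcorner> \<beta>) is \<alpha>"

definition sigma_op :: "nat \<Rightarrow> form \<Rightarrow> form \<Rightarrow> form" where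
  "sigma_op j \<alpha> \<beta> = (\<Sum>I | I \<subseteq> {1..8} \<and> card I = j.
     iprods (sorted_list_of_set I) \<alpha> \<and>\<^sub>\<Lambda> iprods (sorted_list_of_set I) \<beta>)"

text \<open>The contraction of a form of degree \<open>k\<close> into a form of degree at least \<open>k\<close>.\<close>

abbreviation contr :: "nat \<Rightarrow> form \<Rightarrow> form \<Rightarrow> form" where
  "contr k \<alpha> \<beta> \<equiv> sigma_op k \<alpha> \<beta>"

definition frm_inner :: "form \<Rightarrow> form \<Rightarrow> real" where
  "frm_inner \<alpha> \<beta> = (\<Sum>I\<in>Pow {1..8}.
     \<alpha> (map eb (sorted_list_of_set I)) * \<beta> (map eb (sorted_list_of_set I)))"

text \<open>
  The Hodge operator is linear and sends \<open>ew I\<close> to the contraction of \<open>ew I\<close> into \<open>vol\<close>, that is,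
  to \<open>\<plusminus> ew J\<close> with \<open>J\<close> complementary to \<open>I\<close> and \<open>ew I \<and>\<^sub>\<Lambda> (\<plusminus> ew J) = vol\<close>.
\<close>

definition hodge :: "form \<Rightarrow> form" where
  "hodge \<alpha> = (\<lambda>vs. \<Sum>I\<in>Pow {1..8}.
     \<alpha> (map eb (sorted_list_of_set I)) * vol (map eb (sorted_list_of_set I) @ vs))"

section \<open>The model 3-form and the modules it determines\<close>

definition rho0 :: form where
  "rho0 = ew [2,4,6] - ew [2,3,5] - ew [1,4,5] - ew [1,3,6]
     + (ew [1,2] + ew [3,4] - 2 \<cdot> ew [5,6]) \<and>\<^sub>\<Lambda> ew [7]
     + sqrt 3 \<cdot> ((ew [1,2] - ew [3,4]) \<and>\<^sub>\<Lambda> ew [8])"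

definition sigma_plus :: "form \<Rightarrow> form" where
  "sigma_plus \<alpha> = sigma_op 1 rho0 \<alpha>"

definition Lam2_8 :: "form set" where
  "Lam2_8 = sigma_plus ` Lam 1"

definition Lam2_20 :: "form set" where
  "Lam2_20 = {\<omega> \<in> Lam 2. \<omega> \<and>\<^sub>\<Lambda> hodge rho0 = 0}"

definition Lam3_8 :: "form set" where
  "Lam3_8 = {hodge (\<omega> \<and>\<^sub>\<Lambda> rho0) | \<omega>. \<omega> \<in> Lam2_8}"

definition Lam3_20 :: "form set" where
  "Lam3_20 = sigma_plus ` Lam2_20"

definition Lam3_27 :: "form set" where
  "Lam3_27 = {T \<in> Lam 3. T \<and>\<^sub>\<Lambda> rho0 = 0 \<and> T \<and>\<^sub>\<Lambda> hodge rho0 = 0}"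

definition Lam4_8 :: "form set" where
  "Lam4_8 = sigma_plus ` Lam3_8"

definition Lam4_27 :: "form set" where
  "Lam4_27 = sigma_plus ` Lam3_27"

text \<open>
  The orthogonal projection onto the complement of \<open>psu(3)\<close> in \<open>so(8)\<close>.  A skew-symmetric matrix
  \<open>(\<omega> i j)\<close> is identified with the 2-form \<open>\<Sum>i<j. \<omega> i j \<cdot> ew [i, j]\<close>.
\<close>

definition pr_m :: "form \<Rightarrow> form" where
  "pr_m \<omega> = (THE \<mu>. \<mu> \<in> Lam2_20 \<and> (\<forall>\<nu>\<in>Lam2_20. frm_inner (\<omega> - \<mu>) \<nu> = 0))"

text \<open>
  Elements of the tensor product of 8-space with \<open>Lam 2\<close> are represented as linear maps: \<open>X \<otimes> \<omega>\<close>
  is the map \<open>Y \<mapsto> (X \<bullet> Y) \<cdot> \<omega>\<close>.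
\<close>

type_synonym tens = "vec8 \<Rightarrow> form"

definition tensor :: "vec8 \<Rightarrow> form \<Rightarrow> tens" where
  "tensor X \<omega> = (\<lambda>Y. (X \<bullet> Y) \<cdot> \<omega>)"

definition tscale :: "real \<Rightarrow> tens \<Rightarrow> tens" where
  "tscale r t = (\<lambda>Y. r \<cdot> t Y)"

definition Theta1 :: "form \<Rightarrow> tens" where
  "Theta1 T = tscale (- 1 / 2) (\<Sum>i\<in>{1..8}. tensor (eb i) (pr_m (eb i \<lrcorner> T)))"

definition Theta2 :: "form \<Rightarrow> tens" where
  "Theta2 F = - (\<Sum>i\<in>{1..8}. tensor (eb i) (pr_m (contr 2 (eb i \<lrcorner> rho0) F)))"

definition W1 :: "tens set" where "W1 = Theta1 ` Lam3_8"
definition W2 :: "tens set" where "W2 = Theta1 ` Lam3_20"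
definition W3 :: "tens set" where "W3 = Theta1 ` Lam3_27"
definition W4 :: "tens set" where "W4 = Theta2 ` hodge ` Lam4_8"
definition W5 :: "tens set" where "W5 = Theta2 ` hodge ` Lam4_27"

section \<open>Oriented smooth 8-manifolds and tensor fields\<close>

primrec k_smooth_on :: "nat \<Rightarrow> vec8 set \<Rightarrow> (vec8 \<Rightarrow> 'b::real_normed_vector) \<Rightarrow> bool" where
  "k_smooth_on 0 S f \<longleftrightarrow> continuous_on S f"
| "k_smooth_on (Suc k) S f \<longleftrightarrow> (\<forall>x\<in>S. f differentiable (at x)) \<and>
     (\<forall>v. k_smooth_on k S (\<lambda>x. frechet_derivative f (at x) v))"

text \<open>Only used for open \<open>S\<close>.\<close>

definition smooth_on :: "vec8 set \<Rightarrow> (vec8 \<Rightarrow> 'b::real_normed_vector) \<Rightarrow> bool" where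
  "smooth_on S f \<longleftrightarrow> (\<forall>k. k_smooth_on k S f)"

text \<open>A chart is a pair of its domain and its coordinate map.\<close>

type_synonym 'a chart = "'a set \<times> ('a \<Rightarrow> vec8)"

definition chart_image :: "'a chart \<Rightarrow> vec8 set" where
  "chart_image c = snd c ` fst c"

definition chart_inv :: "'a chart \<Rightarrow> vec8 \<Rightarrow> 'a" where
  "chart_inv c = inv_into (fst c) (snd c)"

definition overlap :: "'a chart \<Rightarrow> 'a chart \<Rightarrow> vec8 set" where
  "overlap c c' = snd c ` (fst c \<inter> fst c')"

definition transition :: "'a chart \<Rightarrow> 'a chart \<Rightarrow> vec8 \<Rightarrow> vec8" where
  "transition c c' = snd c' \<circ> chart_inv c"

definition oriented_atlas :: "('a::topological_space) chart set \<Rightarrow> bool" where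
  "oriented_atlas A \<longleftrightarrow>
     (\<forall>c\<in>A. open (fst c) \<and> open (chart_image c) \<and>
        homeomorphism (fst c) (chart_image c) (snd c) (chart_inv c)) \<and>
     (\<Union>c\<in>A. fst c) = UNIV \<and>
     (\<forall>c\<in>A. \<forall>c'\<in>A. smooth_on (overlap c c') (transition c c') \<and>
        (\<forall>x\<in>overlap c c'. det (matrix (frechet_derivative (transition c c') (at x))) > 0))"

definition pullback :: "(vec8 \<Rightarrow> vec8) \<Rightarrow> form \<Rightarrow> form" where
  "pullback L \<alpha> = (\<lambda>vs. \<alpha> (map L vs))"

text \<open>
  A covariant tensor field is given by its coordinate expressions: \<open>t c x\<close> is the value, in the
  chart \<open>c\<close>, at the point of the manifold with coordinates \<open>x\<close>; tangent vectors at this point are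
  given by their coordinates in \<open>c\<close>.  Outside of the chart images the value is irrelevant.
\<close>

type_synonym 'a tfield = "'a chart \<Rightarrow> vec8 \<Rightarrow> form"

definition tensor_field :: "('a::topological_space) chart set \<Rightarrow> nat \<Rightarrow> 'a tfield \<Rightarrow> bool" where
  "tensor_field A k t \<longleftrightarrow>
     (\<forall>c\<in>A. (\<forall>x\<in>chart_image c. multilinear_form k (t c x)) \<and>
        (\<forall>vs. smooth_on (chart_image c) (\<lambda>x. t c x vs))) \<and>
     (\<forall>c\<in>A. \<forall>c'\<in>A. \<forall>x\<in>overlap c c'.
        t c x = pullback (frechet_derivative (transition c c') (at x)) (t c' (transition c c' x)))"

definition diff_form :: "('a::topological_space) chart set \<Rightarrow> nat \<Rightarrow> 'a tfield \<Rightarrow> bool" where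
  "diff_form A k \<alpha> \<longleftrightarrow> tensor_field A k \<alpha> \<and> (\<forall>c\<in>A. \<forall>x\<in>chart_image c. \<alpha> c x \<in> Lam k)"

definition riemannian_metric :: "('a::topological_space) chart set \<Rightarrow> 'a tfield \<Rightarrow> bool" where
  "riemannian_metric A g \<longleftrightarrow> tensor_field A 2 g \<and>
     (\<forall>c\<in>A. \<forall>x\<in>chart_image c.
        (\<forall>u v. g c x [u, v] = g c x [v, u]) \<and> (\<forall>u. u \<noteq> 0 \<longrightarrow> g c x [u, u] > 0))"

section \<open>PSU(3)-structures\<close>

text \<open>
  A frame at a point consists of the vectors \<open>f 1, \<dots>, f 8\<close> (in the coordinates of a chart).  It is
  identified with the linear map sending \<open>eb i\<close> to \<open>f i\<close>, by which forms on the tangent space are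
  transferred to the model space, where the algebraic operations are defined, and back.
\<close>

type_synonym frame = "nat \<Rightarrow> vec8"

definition frame_map :: "frame \<Rightarrow> vec8 \<Rightarrow> vec8" where
  "frame_map f v = (\<Sum>i\<in>{1..8}. (v \<bullet> eb i) *\<^sub>R f i)"

definition in_frame :: "frame \<Rightarrow> form \<Rightarrow> form" where
  "in_frame f \<alpha> = pullback (frame_map f) \<alpha>"

definition from_frame :: "frame \<Rightarrow> form \<Rightarrow> form" where
  "from_frame f \<alpha> = pullback (inv (frame_map f)) \<alpha>"

definition oriented_orthonormal :: "form \<Rightarrow> frame \<Rightarrow> bool" where
  "oriented_orthonormal G f \<longleftrightarrow>
     (\<forall>i\<in>{1..8}. \<forall>j\<in>{1..8}. G [f i, f j] = (if i = j then 1 else 0)) \<and>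
     det (matrix (frame_map f)) > 0"

definition adapted_frame :: "form \<Rightarrow> form \<Rightarrow> frame \<Rightarrow> bool" where
  "adapted_frame G R f \<longleftrightarrow> oriented_orthonormal G f \<and> in_frame f R = rho0"

definition psu3_structure ::
  "('a::topological_space) chart set \<Rightarrow> 'a tfield \<Rightarrow> 'a tfield \<Rightarrow> bool" where
  "psu3_structure A g \<rho> \<longleftrightarrow>
     oriented_atlas A \<and> riemannian_metric A g \<and> diff_form A 3 \<rho> \<and>
     (\<forall>c\<in>A. \<forall>x\<in>chart_image c. \<exists>f. adapted_frame (g c x) (\<rho> c x) f)"

section \<open>Connections, differential and co-differential\<close>

text \<open>
  These act on coordinate expressions in a fixed chart.  A linear connection is given at each point
  by the bilinear map sending \<open>u, v\<close> to the covariant derivative along \<open>u\<close> of the vector field with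
  constant coordinates \<open>v\<close>.  The Levi-Civita connection is the torsion-free metric one.
\<close>

definition levi_civita :: "(vec8 \<Rightarrow> form) \<Rightarrow> vec8 \<Rightarrow> vec8 \<Rightarrow> vec8 \<Rightarrow> vec8" where
  "levi_civita G x = (THE \<Gamma>. bilinear \<Gamma> \<and> (\<forall>u v. \<Gamma> u v = \<Gamma> v u) \<and>
     (\<forall>z u v. frechet_derivative (\<lambda>y. G y [u, v]) (at x) z = G x [\<Gamma> z u, v] + G x [u, \<Gamma> z v]))"

definition cov_vec :: "(vec8 \<Rightarrow> vec8 \<Rightarrow> vec8) \<Rightarrow> (vec8 \<Rightarrow> vec8) \<Rightarrow> vec8 \<Rightarrow> vec8 \<Rightarrow> vec8" where
  "cov_vec \<Gamma> Y x u = frechet_derivative Y (at x) u + \<Gamma> u (Y x)"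

definition cov_form :: "(vec8 \<Rightarrow> vec8 \<Rightarrow> vec8) \<Rightarrow> (vec8 \<Rightarrow> form) \<Rightarrow> vec8 \<Rightarrow> vec8 \<Rightarrow> form" where
  "cov_form \<Gamma> \<alpha> x u = (\<lambda>vs. frechet_derivative (\<lambda>y. \<alpha> y vs) (at x) u
     - (\<Sum>i<length vs. \<alpha> x (vs[i := \<Gamma> u (vs ! i)])))"

definition ext_d :: "(vec8 \<Rightarrow> form) \<Rightarrow> vec8 \<Rightarrow> form" where
  "ext_d \<alpha> x = (\<lambda>vs. \<Sum>i<length vs.
     (- 1) ^ i * frechet_derivative (\<lambda>y. \<alpha> y (take i vs @ drop (Suc i) vs)) (at x) (vs ! i))"

text \<open>The frame \<open>f\<close> at \<open>x\<close> is to be orthonormal.\<close>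

definition codiff :: "(vec8 \<Rightarrow> form) \<Rightarrow> frame \<Rightarrow> (vec8 \<Rightarrow> form) \<Rightarrow> vec8 \<Rightarrow> form" where
  "codiff G f \<alpha> x = - (\<Sum>i\<in>{1..8}. f i \<lrcorner> cov_form (levi_civita G x) \<alpha> x (f i))"

section \<open>Intrinsic torsion and characteristic connection\<close>

definition local_adapted_frame ::
  "(vec8 \<Rightarrow> form) \<Rightarrow> (vec8 \<Rightarrow> form) \<Rightarrow> vec8 set \<Rightarrow> (nat \<Rightarrow> vec8 \<Rightarrow> vec8) \<Rightarrow> bool" where
  "local_adapted_frame G R U E \<longleftrightarrow> open U \<and> (\<forall>i\<in>{1..8}. smooth_on U (E i)) \<and>
     (\<forall>x\<in>U. adapted_frame (G x) (R x) (\<lambda>i. E i x))"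

definition connection_form ::
  "(vec8 \<Rightarrow> form) \<Rightarrow> (nat \<Rightarrow> vec8 \<Rightarrow> vec8) \<Rightarrow> vec8 \<Rightarrow> nat \<Rightarrow> nat \<Rightarrow> vec8 \<Rightarrow> real" where
  "connection_form G E x i j u = G x [cov_vec (levi_civita G x) (E i) x u, E j x]"

definition Omega :: "(vec8 \<Rightarrow> form) \<Rightarrow> (nat \<Rightarrow> vec8 \<Rightarrow> vec8) \<Rightarrow> vec8 \<Rightarrow> tens" where
  "Omega G E x = (\<Sum>k\<in>{1..8}. tensor (eb k)
     (\<Sum>(i, j) | 1 \<le> i \<and> i < j \<and> j \<le> 8. connection_form G E x i j (E k x) \<cdot> ew [i, j]))"

definition intrinsic_torsion :: "(vec8 \<Rightarrow> form) \<Rightarrow> (nat \<Rightarrow> vec8 \<Rightarrow> vec8) \<Rightarrow> vec8 \<Rightarrow> tens" where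
  "intrinsic_torsion G E x = (\<lambda>X. pr_m (Omega G E x X))"

definition type_W1_to_W5 ::
  "('a::topological_space) chart set \<Rightarrow> 'a tfield \<Rightarrow> 'a tfield \<Rightarrow> bool" where
  "type_W1_to_W5 A g \<rho> \<longleftrightarrow>
     (\<forall>c\<in>A. \<forall>U\<subseteq>chart_image c. \<forall>E. local_adapted_frame (g c) (\<rho> c) U E \<longrightarrow>
        (\<forall>x\<in>U. intrinsic_torsion (g c) E x \<in> W1 + W2 + W3 + W4 + W5))"

definition characteristic_forms ::
  "('a::topological_space) chart set \<Rightarrow> 'a tfield \<Rightarrow> 'a tfield \<Rightarrow> 'a tfield \<Rightarrow> 'a tfield \<Rightarrow> bool" where
  "characteristic_forms A g \<rho> Tc Fc \<longleftrightarrow>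
     diff_form A 3 Tc \<and> diff_form A 4 Fc \<and>
     (\<forall>c\<in>A. \<forall>x\<in>chart_image c. \<forall>f. adapted_frame (g c x) (\<rho> c x) f \<longrightarrow>
        in_frame f (Tc c x) \<in> Lam3_8 + Lam3_20 + Lam3_27 \<and>
        in_frame f (Fc c x) \<in> hodge ` Lam4_8 + hodge ` Lam4_27) \<and>
     (\<forall>c\<in>A. \<forall>U\<subseteq>chart_image c. \<forall>E. local_adapted_frame (g c) (\<rho> c) U E \<longrightarrow>
        (\<forall>x\<in>U. \<exists>\<Gamma>1\<in>W1. \<exists>\<Gamma>2\<in>W2. \<exists>\<Gamma>3\<in>W3. \<exists>\<Gamma>4\<in>W4. \<exists>\<Gamma>5\<in>W5.
           intrinsic_torsion (g c) E x = \<Gamma>1 + \<Gamma>2 + \<Gamma>3 + \<Gamma>4 + \<Gamma>5 \<and>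
           Theta1 (in_frame (\<lambda>i. E i x) (Tc c x)) = \<Gamma>1 + \<Gamma>2 + \<Gamma>3 \<and>
           Theta2 (in_frame (\<lambda>i. E i x) (Fc c x)) = \<Gamma>4 + \<Gamma>5))"

text \<open>
  The characteristic connection at the point \<open>x\<close> of a chart in which the metric is \<open>G\<close>; \<open>R\<close>, \<open>T\<close>,
  \<open>F\<close> are the values of the three forms at \<open>x\<close> and \<open>f\<close> is an adapted frame at \<open>x\<close>, on which the
  result does not depend.
\<close>

definition characteristic_connection ::
  "(vec8 \<Rightarrow> form) \<Rightarrow> vec8 \<Rightarrow> frame \<Rightarrow> form \<Rightarrow> form \<Rightarrow> form \<Rightarrow> vec8 \<Rightarrow> vec8 \<Rightarrow> vec8" where
  "characteristic_connection G x f R T F X Y = (THE w. \<forall>Z.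
     G x [w, Z] = G x [levi_civita G x X Y, Z] + 1 / 2 * T [X, Y, Z]
       + from_frame f (contr 2 (in_frame f (X \<lrcorner> R)) (in_frame f F)) [Y, Z])"

definition characteristically_parallel ::
  "('a::topological_space) chart set \<Rightarrow> 'a tfield \<Rightarrow> 'a tfield \<Rightarrow> 'a tfield \<Rightarrow> 'a tfield \<Rightarrow> 'a tfield \<Rightarrow> bool"
  where
  "characteristically_parallel A g \<rho> Tc Fc \<alpha> \<longleftrightarrow>
     (\<forall>c\<in>A. \<forall>x\<in>chart_image c. \<forall>f. adapted_frame (g c x) (\<rho> c x) f \<longrightarrow>
        (\<forall>u. cov_form (characteristic_connection (g c) x f (\<rho> c x) (Tc c x) (Fc c x)) (\<alpha> c) x u = 0))"

end

theory Submission
  imports Defs "HOL-Combinatorics.Multiset_Permutations"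
begin

text \<open>
  Write \<open>S u\<close> for the contraction of \<open>u \<lrcorner> rho0\<close> into \<open>F\<close>.  The characteristic connection differs from the
  Levi-Civita connection by the 2-form \<open>1/2 (u \<lrcorner> T) + S u\<close>, so for a parallel form the Levi-Civita
  derivative is the algebraic action of that 2-form.  Contracting gives the co-differential;
  alternating gives the differential, where the sum over \<open>j\<close> of \<open>e j \<and> (e k \<lrcorner> S (e j))\<close> must be \<open>S (e k)\<close>,
  that is, the cyclic sum of \<open>S u [v, w]\<close> must vanish.  This is where the type of \<open>F\<close> enters:
  \<open>F = hodge (sigma_plus \<tau>)\<close>, and \<open>rho0 [u, v, w]\<close> is \<open>[u, v] \<bullet> w\<close> for the Lie bracket of \<open>su(3)\<close>.  Since
  \<open>ad u\<close> annihilates the volume form, the cyclic sum is, up to a factor, \<open>hodge (sigma_plus (sigma_plus \<tau>))\<close>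
  evaluated at \<open>u, v, w\<close>, and \<open>sigma_plus\<close> squares to zero by the Jacobi identity.
\<close>

section \<open>Alternating forms and the wedge product\<close>

text \<open>The frame \<open>f\<close> exists at one point only and is never differentiated.
  Arguments of forms are held constant in coordinates, so the Levi-Civita connection enters as a
  symmetric bilinear map: symmetry removes it from the differential, and in the co-differential the
  correction terms of the covariant derivative cancel it. What remains is algebra in the model
  space.

  That \<open>sigma_plus\<close> squares to zero is used in unfolded form, as a sum of products of
  two factors \<open>rho0\<close> and one factor \<tau>, paired with a top form. The outer
  \<open>rho0\<close> carries an index \<open>p\<close>, which is contracted either with the inner
  \<open>rho0\<close> or with \<tau>. In the first case both factors \<open>rho0\<close> share
  \<open>p\<close>, and the top form, being alternating, singles out the Jacobi sum. In the second
  case they are linked only through \<open>\<tau> [eb i, eb p, eb s]\<close>, which is skew in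
  \<open>i\<close> and \<open>p\<close>, while the rest is symmetric in them. Hence Jacobi settles
  one half of the terms and a parity argument the other.

  Shuffle sums are unsuited to induction, so the wedge product is handled through one recursion on
  the argument list: contraction is an antiderivation.\<close>

lemma form_sum_apply: "(\<Sum>i\<in>A. (\<alpha> i :: form)) vs = (\<Sum>i\<in>A. \<alpha> i vs)"
  by (induction A rule: infinite_finite_induct) auto

lemma fscale_apply [simp]: "(r \<cdot> \<alpha>) vs = r * \<alpha> vs"
  by (simp add: fscale_def)

lemma iprod_apply [simp]: "(X \<lrcorner> \<alpha>) vs = \<alpha> (X # vs)"
  by (simp add: iprod_def)

lemma Lam_length: "\<alpha> \<in> Lam k \<Longrightarrow> length vs \<noteq> k \<Longrightarrow> \<alpha> vs = 0"
  by (auto simp: Lam_def multilinear_form_def)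

lemma Lam_linear:
  assumes "\<alpha> \<in> Lam k"
  shows "linear (\<lambda>v. \<alpha> (us @ v # vs))"
proof (cases "length (us @ 0 # vs) = k")
  case True
  then have "linear (\<lambda>v. \<alpha> ((us @ 0 # vs)[length us := v]))"
    using assms unfolding Lam_def multilinear_form_def by (auto simp del: list_update_length)
  then show ?thesis by simp
next
  case False
  then have "(\<lambda>v. \<alpha> (us @ v # vs)) = (\<lambda>v. 0)"
    using Lam_length[OF assms] by auto
  then show ?thesis by (simp add: linear_zero)
qed

lemma Lam_eq_zero:
  "\<alpha> \<in> Lam k \<Longrightarrow> i < j \<Longrightarrow> j < length vs \<Longrightarrow> vs ! i = vs ! j \<Longrightarrow> \<alpha> vs = 0"
  unfolding Lam_def by blast

lemma Lam_alternating:
  assumes "\<alpha> \<in> Lam k"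
  shows "\<alpha> (us @ v # vs @ v # ws) = 0"
  by (rule Lam_eq_zero[OF assms, of "length us" "length us + Suc (length vs)"])
    (simp_all add: nth_append)

lemma Lam_swap:
  assumes "\<alpha> \<in> Lam k"
  shows "\<alpha> (us @ v # vs @ w # ws) = - \<alpha> (us @ w # vs @ v # ws)"
proof -
  have 1: "linear (\<lambda>x. \<alpha> (us @ x # vs @ y # ws))" for y
    using Lam_linear[OF assms, of us "vs @ y # ws"] by simp
  have 2: "linear (\<lambda>x. \<alpha> (us @ y # vs @ x # ws))" for y
    using Lam_linear[OF assms, of "us @ y # vs" ws] by simp
  have "0 = \<alpha> (us @ (v + w) # vs @ (v + w) # ws)"
    using Lam_alternating[OF assms] by simp
  also have "\<dots> = \<alpha> (us @ v # vs @ w # ws) + \<alpha> (us @ w # vs @ v # ws)"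
    by (simp only: linear_add[OF 1] linear_add[OF 2]) (simp add: Lam_alternating[OF assms])
  finally show ?thesis by linarith
qed

lemma Lam_zero [simp, intro]: "0 \<in> Lam k"
  by (auto simp: Lam_def multilinear_form_def linear_zero)

lemma Lam_add [intro]: "\<alpha> \<in> Lam k \<Longrightarrow> \<beta> \<in> Lam k \<Longrightarrow> \<alpha> + \<beta> \<in> Lam k"
  unfolding Lam_def multilinear_form_def
  by (auto intro!: linear_compose_add)

lemma Lam_scale [intro]: "\<alpha> \<in> Lam k \<Longrightarrow> r \<cdot> \<alpha> \<in> Lam k"
  using linear_compose_scale_right[where c = r and 'b = real]
  by (auto simp: Lam_def multilinear_form_def)

lemma Lam_uminus [intro]: "\<alpha> \<in> Lam k \<Longrightarrow> - \<alpha> \<in> Lam k"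
  using Lam_scale[of \<alpha> k "-1"] by (simp add: fscale_def fun_Compl_def)

lemma Lam_diff [intro]: "\<alpha> \<in> Lam k \<Longrightarrow> \<beta> \<in> Lam k \<Longrightarrow> \<alpha> - \<beta> \<in> Lam k"
  using Lam_add[OF _ Lam_uminus, of \<alpha> k \<beta>] by (simp add: fun_diff_def fun_Compl_def plus_fun_def)

lemma Lam_sum [intro]: "(\<And>i. i \<in> A \<Longrightarrow> \<alpha> i \<in> Lam k) \<Longrightarrow> (\<Sum>i\<in>A. \<alpha> i) \<in> Lam k"
  by (induction A rule: infinite_finite_induct) auto

lemma Lam_iprod [intro]:
  assumes "\<alpha> \<in> Lam (Suc k)"
  shows "v \<lrcorner> \<alpha> \<in> Lam k"
proof -
  have "linear (\<lambda>x. \<alpha> (v # vs[i := x]))" if "i < length vs" for vs i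
    using Lam_linear[OF assms, of "v # take i vs" "drop (Suc i) vs"] that
    by (simp add: upd_conv_take_nth_drop)
  moreover have "\<alpha> (v # vs) = 0" if "i < j" "j < length vs" "vs ! i = vs ! j" for vs i j
    using Lam_eq_zero[OF assms, of "Suc i" "Suc j" "v # vs"] that by simp
  ultimately show ?thesis
    using Lam_length[OF assms] by (auto simp: Lam_def multilinear_form_def)
qed

lemma Lam_iprod' [intro]: "\<alpha> \<in> Lam (Suc k) \<Longrightarrow> (\<lambda>vs. \<alpha> (v # vs)) \<in> Lam k"
  using Lam_iprod unfolding iprod_def .

text \<open>An inductive criterion for being alternating. Since every
  \<open>v \<lrcorner> \<alpha>\<close> is already alternating, only a repetition that involves the
  head is at stake; polarising the condition on the first two slots lets the head trade places with
  its neighbour, which puts both equal vectors into the tail.\<close>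

lemma Lam_SucI:
  assumes Nil: "\<alpha> [] = 0"
    and tail: "\<And>v. v \<lrcorner> \<alpha> \<in> Lam k"
    and lin: "\<And>vs. linear (\<lambda>v. \<alpha> (v # vs))"
    and alt: "\<And>v vs. \<alpha> (v # v # vs) = 0"
  shows "\<alpha> \<in> Lam (Suc k)"
proof -
  have len: "\<alpha> vs = 0" if "length vs \<noteq> Suc k" for vs
    using that Nil Lam_length[OF tail] by (cases vs) auto
  have lin': "linear (\<lambda>x. \<alpha> (vs[i := x]))" if i: "i < length vs" for vs i
  proof (cases i)
    case 0
    then show ?thesis using lin i by (cases vs) auto
  next
    case (Suc j)
    then obtain w ws where "vs = w # ws" using i by (cases vs) auto
    then show ?thesis
      using Lam_linear[OF tail, of w "take j ws" "drop (Suc j) ws"] Suc i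
      by (simp add: upd_conv_take_nth_drop)
  qed
  have swap: "\<alpha> (v # w # vs) = - \<alpha> (w # v # vs)" for v w vs
  proof -
    have lin2: "linear (\<lambda>x. \<alpha> (y # x # vs))" for y
      using Lam_linear[OF tail, of y "[]"] by simp
    have "\<alpha> ((v + w) # (v + w) # vs) = \<alpha> (v # w # vs) + \<alpha> (w # v # vs)"
      by (simp only: linear_add[OF lin] linear_add[OF lin2]) (simp add: alt)
    then show ?thesis using alt[of "v + w" vs] by simp
  qed
  have head: "\<alpha> (v # ws @ v # zs) = 0" for v ws zs
  proof (cases ws)
    case (Cons w us)
    then have "\<alpha> (v # ws @ v # zs) = - (w \<lrcorner> \<alpha>) (v # us @ v # zs)"
      using swap[of v w] by simp
    also have "\<dots> = 0" using Lam_alternating[OF tail, of w "[]" v us zs] by simp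
    finally show ?thesis .
  qed (use alt in simp)
  have "\<alpha> vs = 0" if ij: "i < j" "j < length vs" "vs ! i = vs ! j" for vs i j
  proof (cases vs)
    case (Cons v ws)
    show ?thesis
    proof (cases i)
      case 0
      then have "ws = take (j - 1) ws @ v # drop j ws"
        using id_take_nth_drop[of "j - 1" ws] ij Cons by (cases j) auto
      then show ?thesis using head[of v "take (j - 1) ws" "drop j ws"] Cons by simp
    next
      case (Suc i')
      then have "(v \<lrcorner> \<alpha>) ws = 0"
        using Lam_eq_zero[OF tail, of i' "j - 1" ws v] ij Cons by (cases j) auto
      then show ?thesis using Cons by simp
    qed
  qed (use ij in simp)
  then show ?thesis using len lin' by (auto simp: Lam_def multilinear_form_def)
qed

lemma iprod_Lam_0: "\<alpha> \<in> Lam 0 \<Longrightarrow> v \<lrcorner> \<alpha> = 0"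
  by (auto simp: iprod_def Lam_length)

lemma Lam_0_iff: "\<alpha> \<in> Lam 0 \<longleftrightarrow> (\<forall>v vs. \<alpha> (v # vs) = 0)"
proof
  assume "\<forall>v vs. \<alpha> (v # vs) = 0"
  then have *: "\<alpha> vs = 0" if "vs \<noteq> []" for vs
    using that by (cases vs) auto
  show "\<alpha> \<in> Lam 0" by (auto simp: Lam_def multilinear_form_def intro!: * )
qed (simp add: Lam_length)

section \<open>The wedge product as a recursion on the argument list\<close>

lemma wedge_Nil: "(\<alpha> \<and>\<^sub>\<Lambda> \<beta>) [] = \<alpha> [] * \<beta> []"
  by (simp add: wedge_def shuffle_sign_def)

lemma shuffle_sign_insert_0: "shuffle_sign (insert 0 (Suc ` S)) = shuffle_sign S"
proof -
  have "{(a, b). a \<in> insert 0 (Suc ` S) \<and> b \<notin> insert 0 (Suc ` S) \<and> b < a} =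
      (\<lambda>(a, b). (Suc a, Suc b)) ` {(a, b). a \<in> S \<and> b \<notin> S \<and> b < a}" (is "?L = ?f ` ?R")
  proof (rule set_eqI)
    fix z :: "nat \<times> nat"
    obtain a b where "z = (a, b)" by fastforce
    then show "z \<in> ?L \<longleftrightarrow> z \<in> ?f ` ?R" by (cases a; cases b) (auto simp: image_iff)
  qed
  moreover have "inj_on ?f ?R" by (auto simp: inj_on_def)
  ultimately show ?thesis by (simp add: shuffle_sign_def card_image)
qed

text \<open>The new index 0 lies outside the shifted set and below all of its elements, so each of
  them gains exactly one inversion.\<close>

lemma shuffle_sign_Suc:
  assumes "finite S"
  shows "shuffle_sign (Suc ` S) = (- 1) ^ card S * shuffle_sign S"
proof -
  let ?R = "{(a, b). a \<in> S \<and> b \<notin> S \<and> b < a}" and ?f = "\<lambda>(a, b). (Suc a, Suc b)"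
  let ?g = "\<lambda>a. (Suc a, 0 :: nat)"
  have "{(a, b). a \<in> Suc ` S \<and> b \<notin> Suc ` S \<and> b < a} = ?g ` S \<union> ?f ` ?R" (is "?L = _")
  proof (rule set_eqI)
    fix z :: "nat \<times> nat"
    obtain a b where "z = (a, b)" by fastforce
    then show "z \<in> ?L \<longleftrightarrow> z \<in> ?g ` S \<union> ?f ` ?R" by (cases a; cases b) (auto simp: image_iff)
  qed
  moreover have "finite ?R"
    by (rule finite_subset[of _ "Sigma S (\<lambda>a. {..<a})"]) (use assms in auto)
  moreover have "card (?f ` ?R) = card ?R" by (rule card_image) (auto simp: inj_on_def)
  moreover have "card (?g ` S) = card S" by (rule card_image) (auto simp: inj_on_def)
  moreover have "?g ` S \<inter> ?f ` ?R = {}" by auto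
  ultimately have "card ?L = card S + card ?R" using assms by (simp add: card_Un_disjoint)
  then show ?thesis by (simp add: shuffle_sign_def power_add)
qed

text \<open>The shuffles are split by whether the head index 0 goes to \<alpha> or to \<beta>. This
  antiderivation rule replaces the definition of the wedge product in most of the algebra
  below.\<close>

lemma wedge_Cons:
  assumes "\<alpha> \<in> Lam p"
  shows "(\<alpha> \<and>\<^sub>\<Lambda> \<beta>) (v # vs) = (v \<lrcorner> \<alpha> \<and>\<^sub>\<Lambda> \<beta>) vs + (- 1) ^ p * (\<alpha> \<and>\<^sub>\<Lambda> (v \<lrcorner> \<beta>)) vs"
proof -
  define n where "n = length vs"
  let ?t = "\<lambda>S. shuffle_sign S * \<alpha> (nths (v # vs) S) * \<beta> (nths (v # vs) (- S))"
  let ?f = "\<lambda>S. Suc ` S" and ?g = "\<lambda>S. insert 0 (Suc ` S)"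
  have inj: "inj_on ?f (Pow {..<n})" "inj_on ?g (Pow {..<n})"
    by (auto simp: inj_on_def) 
  have "S \<in> ?f ` Pow {..<n} \<union> ?g ` Pow {..<n}" if "S \<in> Pow {..<Suc n}" for S
  proof -
    let ?S = "{i. Suc i \<in> S}"
    have "S = (if 0 \<in> S then ?g ?S else ?f ?S)"
    proof (rule set_eqI)
      fix x show "x \<in> S \<longleftrightarrow> x \<in> (if 0 \<in> S then ?g ?S else ?f ?S)"
        by (cases x) (auto simp: image_iff)
    qed
    moreover have "?S \<in> Pow {..<n}" using that by auto
    ultimately show ?thesis by (auto split: if_splits)
  qed
  then have Pow: "Pow {..<Suc n} = ?f ` Pow {..<n} \<union> ?g ` Pow {..<n}"
    by (auto simp: less_Suc_eq_0_disj)
  \<comment> \<open>The sign gained is \<open>(- 1) ^ card S\<close>; it may be written with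
    \<open>p\<close> because \<alpha> vanishes on lists of any other length.\<close>
  have "?t (?f S) = (- 1) ^ p * (shuffle_sign S * \<alpha> (nths vs S) * \<beta> (v # nths vs (- S)))"
    if "S \<subseteq> {..<n}" for S
  proof -
    have fin: "finite S" using that finite_subset by blast
    have "length (nths vs S) = card S"
      using that by (auto simp: length_nths n_def intro!: arg_cong[of _ _ card])
    moreover have "{j. Suc j \<in> Suc ` S} = S" "{j. Suc j \<notin> Suc ` S} = - S" by auto
    ultimately show ?thesis
      using fin Lam_length[OF assms, of "nths vs S"]
      by (cases "card S = p") (auto simp: shuffle_sign_Suc nths_Cons Compl_eq)
  qed
  then have 1: "(\<Sum>S\<in>Pow {..<n}. ?t (?f S)) = (- 1) ^ p * (\<alpha> \<and>\<^sub>\<Lambda> (v \<lrcorner> \<beta>)) vs"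
    by (simp add: wedge_def n_def sum_distrib_left)
  have "?t (?g S) = shuffle_sign S * \<alpha> (v # nths vs S) * \<beta> (nths vs (- S))" for S
  proof -
    have "{j. Suc j \<in> ?g S} = S" "{j. Suc j \<notin> Suc ` S} = - S" by auto
    then show ?thesis by (simp add: shuffle_sign_insert_0 nths_Cons Compl_eq)
  qed
  then have 2: "(\<Sum>S\<in>Pow {..<n}. ?t (?g S)) = (v \<lrcorner> \<alpha> \<and>\<^sub>\<Lambda> \<beta>) vs"
    by (simp add: wedge_def n_def)
  have "(\<alpha> \<and>\<^sub>\<Lambda> \<beta>) (v # vs) = (\<Sum>S\<in>Pow {..<Suc n}. ?t S)"
    by (simp add: wedge_def n_def)
  also have "\<dots> = (\<Sum>S\<in>?f ` Pow {..<n}. ?t S) + (\<Sum>S\<in>?g ` Pow {..<n}. ?t S)"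
    unfolding Pow by (rule sum.union_disjoint) auto
  also have "\<dots> = (\<Sum>S\<in>Pow {..<n}. ?t (?f S)) + (\<Sum>S\<in>Pow {..<n}. ?t (?g S))"
    using inj by (simp add: sum.reindex del: image_Pow_surj)
  also have "\<dots> = (v \<lrcorner> \<alpha> \<and>\<^sub>\<Lambda> \<beta>) vs + (- 1) ^ p * (\<alpha> \<and>\<^sub>\<Lambda> (v \<lrcorner> \<beta>)) vs"
    unfolding 1 2 by (rule add.commute)
  finally show ?thesis .
qed

lemma wedge_add_left: "(\<alpha> + \<alpha>') \<and>\<^sub>\<Lambda> \<beta> = \<alpha> \<and>\<^sub>\<Lambda> \<beta> + \<alpha>' \<and>\<^sub>\<Lambda> \<beta>"
  by (rule ext) (simp add: wedge_def distrib_left distrib_right sum.distrib)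

lemma wedge_add_right: "\<alpha> \<and>\<^sub>\<Lambda> (\<beta> + \<beta>') = \<alpha> \<and>\<^sub>\<Lambda> \<beta> + \<alpha> \<and>\<^sub>\<Lambda> \<beta>'"
  by (rule ext) (simp add: wedge_def distrib_left distrib_right sum.distrib)

lemma wedge_scale_left: "(r \<cdot> \<alpha>) \<and>\<^sub>\<Lambda> \<beta> = r \<cdot> (\<alpha> \<and>\<^sub>\<Lambda> \<beta>)"
  by (rule ext) (simp add: wedge_def sum_distrib_left mult.assoc mult.left_commute)

lemma wedge_scale_right: "\<alpha> \<and>\<^sub>\<Lambda> (r \<cdot> \<beta>) = r \<cdot> (\<alpha> \<and>\<^sub>\<Lambda> \<beta>)"
  by (rule ext) (simp add: wedge_def sum_distrib_left mult.assoc mult.left_commute)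

lemma wedge_zero_left [simp]: "0 \<and>\<^sub>\<Lambda> \<beta> = 0"
  by (rule ext) (simp add: wedge_def)

lemma wedge_zero_right [simp]: "\<beta> \<and>\<^sub>\<Lambda> 0 = 0"
  by (rule ext) (simp add: wedge_def)

lemma iprod_wedge:
  assumes "\<alpha> \<in> Lam p"
  shows "v \<lrcorner> (\<alpha> \<and>\<^sub>\<Lambda> \<beta>) = (v \<lrcorner> \<alpha>) \<and>\<^sub>\<Lambda> \<beta> + (- 1) ^ p \<cdot> (\<alpha> \<and>\<^sub>\<Lambda> (v \<lrcorner> \<beta>))"
  by (rule ext) (simp add: wedge_Cons[OF assms])

lemma iprod_iprod_self: "\<alpha> \<in> Lam k \<Longrightarrow> v \<lrcorner> v \<lrcorner> \<alpha> = 0"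
  using Lam_alternating[of \<alpha> k "[]" v "[]"] by (simp add: fun_eq_iff)

lemma iprod_add_vec: "\<alpha> \<in> Lam k \<Longrightarrow> (v + w) \<lrcorner> \<alpha> = v \<lrcorner> \<alpha> + w \<lrcorner> \<alpha>"
  using linear_add[OF Lam_linear[of \<alpha> k "[]"]] by (simp add: fun_eq_iff)

lemma iprod_scale_vec: "\<alpha> \<in> Lam k \<Longrightarrow> (r *\<^sub>R v) \<lrcorner> \<alpha> = r \<cdot> (v \<lrcorner> \<alpha>)"
  using linear_scale[OF Lam_linear[of \<alpha> k "[]"]] by (simp add: fun_eq_iff)

text \<open>Induction on the total degree through \<open>Lam_SucI\<close>: contracting either factor
  lowers the degree by one.\<close>

lemma Lam_wedge [intro]:
  assumes "\<alpha> \<in> Lam p" "\<beta> \<in> Lam q"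
  shows "\<alpha> \<and>\<^sub>\<Lambda> \<beta> \<in> Lam (p + q)"
proof -
  have "\<alpha> \<and>\<^sub>\<Lambda> \<beta> \<in> Lam n" if "\<alpha> \<in> Lam p" "\<beta> \<in> Lam q" "n = p + q" for n p q \<alpha> \<beta>
    using that
  proof (induction n arbitrary: p q \<alpha> \<beta>)
    case 0
    then show ?case using iprod_Lam_0[of \<alpha>] iprod_Lam_0[of \<beta>]
      by (auto simp: Lam_0_iff wedge_Cons[OF 0(1)])
  next
    case (Suc n)
    note \<alpha> = Suc.prems(1) and \<beta> = Suc.prems(2)
    show ?case
    proof (rule Lam_SucI)
      show "(\<alpha> \<and>\<^sub>\<Lambda> \<beta>) [] = 0"
        using Suc.prems(3) Lam_length[OF \<alpha>, of "[]"] Lam_length[OF \<beta>, of "[]"]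
        by (cases p) (auto simp: wedge_Nil)
    next
      fix v
      have "v \<lrcorner> \<alpha> \<and>\<^sub>\<Lambda> \<beta> \<in> Lam n"
      proof (cases p)
        case 0
        then show ?thesis using iprod_Lam_0 \<alpha> by simp
      next
        case p: (Suc p')
        show ?thesis by (rule Suc.IH[OF _ \<beta>, of _ p']) (use p Suc.prems in auto)
      qed
      moreover have "\<alpha> \<and>\<^sub>\<Lambda> (v \<lrcorner> \<beta>) \<in> Lam n"
      proof (cases q)
        case 0
        then show ?thesis using iprod_Lam_0 \<beta> by simp
      next
        case q: (Suc q')
        show ?thesis by (rule Suc.IH[OF \<alpha>, of _ q']) (use q Suc.prems in auto)
      qed
      ultimately show "v \<lrcorner> (\<alpha> \<and>\<^sub>\<Lambda> \<beta>) \<in> Lam n" by (auto simp: iprod_wedge[OF \<alpha>])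
    next
      fix vs
      show "linear (\<lambda>v. (\<alpha> \<and>\<^sub>\<Lambda> \<beta>) (v # vs))"
        unfolding wedge_Cons[OF \<alpha>]
        by (rule linearI)
          (simp_all add: iprod_add_vec[OF \<alpha>] iprod_add_vec[OF \<beta>] iprod_scale_vec[OF \<alpha>]
            iprod_scale_vec[OF \<beta>] wedge_add_left wedge_add_right wedge_scale_left
            wedge_scale_right algebra_simps)
    next
      fix v vs
      \<comment> \<open>With \<open>v\<close> inserted twice, the only products that survive are two
        copies of \<open>v \<lrcorner> \<alpha>\<close> wedged with
        \<open>v \<lrcorner> \<beta>\<close>. Their signs \<open>(- 1) ^ (p - 1)\<close> and
        \<open>(- 1) ^ p\<close> are opposite.\<close>
      have *: "(\<alpha> \<and>\<^sub>\<Lambda> (v \<lrcorner> \<beta>)) (v # vs) = (v \<lrcorner> \<alpha> \<and>\<^sub>\<Lambda> (v \<lrcorner> \<beta>)) vs"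
        by (simp add: wedge_Cons[OF \<alpha>] iprod_iprod_self[OF \<beta>])
      show "(\<alpha> \<and>\<^sub>\<Lambda> \<beta>) (v # v # vs) = 0"
      proof (cases p)
        case 0
        then show ?thesis using iprod_Lam_0 \<alpha> by (simp add: wedge_Cons[OF \<alpha>] iprod_iprod_self[OF \<beta>])
      next
        case (Suc p')
        then have "v \<lrcorner> \<alpha> \<in> Lam p'" using \<alpha> by auto
        then show ?thesis using Suc
          by (simp add: wedge_Cons[OF \<alpha>] wedge_Cons * iprod_iprod_self[OF \<alpha>] iprod_iprod_self[OF \<beta>])
      qed
    qed
  qed
  then show ?thesis using assms by blast
qed

declare One_nat_def [simp del]

lemma iprod_zero [simp]: "v \<lrcorner> 0 = 0"
  by (simp add: fun_eq_iff)

lemma wedge_Lam_0: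
  assumes "\<alpha> \<in> Lam 0"
  shows "\<alpha> \<and>\<^sub>\<Lambda> \<beta> = \<alpha> [] \<cdot> \<beta>"
proof
  fix vs
  show "(\<alpha> \<and>\<^sub>\<Lambda> \<beta>) vs = (\<alpha> [] \<cdot> \<beta>) vs"
    by (induction vs arbitrary: \<beta>)
      (simp_all add: wedge_Nil wedge_Cons[OF assms] iprod_Lam_0[OF assms])
qed

lemma wedge_assoc:
  assumes "\<alpha> \<in> Lam p" "\<beta> \<in> Lam q"
  shows "(\<alpha> \<and>\<^sub>\<Lambda> \<beta>) \<and>\<^sub>\<Lambda> \<gamma> = \<alpha> \<and>\<^sub>\<Lambda> (\<beta> \<and>\<^sub>\<Lambda> \<gamma>)"
proof
  fix vs
  show "((\<alpha> \<and>\<^sub>\<Lambda> \<beta>) \<and>\<^sub>\<Lambda> \<gamma>) vs = (\<alpha> \<and>\<^sub>\<Lambda> (\<beta> \<and>\<^sub>\<Lambda> \<gamma>)) vs"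
    using assms
  proof (induction vs arbitrary: p q \<alpha> \<beta> \<gamma>)
    case Nil
    then show ?case by (simp add: wedge_Nil)
  next
    case (Cons v vs)
    note \<alpha> = Cons.prems(1) and \<beta> = Cons.prems(2)
    have 1: "((v \<lrcorner> \<alpha> \<and>\<^sub>\<Lambda> \<beta>) \<and>\<^sub>\<Lambda> \<gamma>) vs = (v \<lrcorner> \<alpha> \<and>\<^sub>\<Lambda> (\<beta> \<and>\<^sub>\<Lambda> \<gamma>)) vs"
    proof (cases p)
      case 0
      then show ?thesis using iprod_Lam_0 \<alpha> by simp
    next
      case (Suc p')
      then show ?thesis using Cons.IH[OF Lam_iprod \<beta>] \<alpha> by blast
    qed
    have 2: "((\<alpha> \<and>\<^sub>\<Lambda> (v \<lrcorner> \<beta>)) \<and>\<^sub>\<Lambda> \<gamma>) vs = (\<alpha> \<and>\<^sub>\<Lambda> (v \<lrcorner> \<beta> \<and>\<^sub>\<Lambda> \<gamma>)) vs"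
    proof (cases q)
      case 0
      then show ?thesis using iprod_Lam_0 \<beta> by simp
    next
      case (Suc q')
      then show ?thesis using Cons.IH[OF \<alpha> Lam_iprod] \<beta> by blast
    qed
    show ?case
      by (simp add: wedge_Cons[OF Lam_wedge[OF \<alpha> \<beta>]] wedge_Cons[OF \<alpha>] iprod_wedge[OF \<alpha>]
          iprod_wedge[OF \<beta>] wedge_add_left wedge_add_right wedge_scale_left wedge_scale_right
          1 2 Cons.IH[OF \<alpha> \<beta>] power_add distrib_left del: iprod_apply)
  qed
qed

text \<open>The right side is the rank-one endomorphism sending \<open>v\<close> to
  \<open>\<theta> [v]\<close> times \<open>y\<close>, extended to forms as a derivation. In the
  induction the sign from moving a contraction past \<theta> is compensated by the exchange of
  \<open>x\<close> and \<open>y\<close> inside \<alpha>.\<close>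

lemma wedge_iprod_right:
  assumes "\<theta> \<in> Lam 1" "\<alpha> \<in> Lam k"
  shows "(\<theta> \<and>\<^sub>\<Lambda> (y \<lrcorner> \<alpha>)) vs = (\<Sum>l<length vs. \<theta> [vs ! l] * \<alpha> (vs[l := y]))"
  using assms(2)
proof (induction vs arbitrary: \<alpha> k)
  case Nil
  then show ?case using Lam_length[OF assms(1), of "[]"] by (simp add: wedge_Nil)
next
  case (Cons x vs)
  have "x \<lrcorner> \<theta> \<in> Lam 0" using assms(1) by (intro Lam_iprod) (simp add: One_nat_def)
  then have 1: "(x \<lrcorner> \<theta> \<and>\<^sub>\<Lambda> (y \<lrcorner> \<alpha>)) vs = \<theta> [x] * \<alpha> (y # vs)"
    by (simp add: wedge_Lam_0)
  have "x \<lrcorner> y \<lrcorner> \<alpha> = (- 1) \<cdot> (y \<lrcorner> x \<lrcorner> \<alpha>)"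
    using Lam_swap[OF Cons.prems, of "[]" y "[]" x] by (simp add: fun_eq_iff)
  then have 2: "(\<theta> \<and>\<^sub>\<Lambda> (x \<lrcorner> y \<lrcorner> \<alpha>)) vs = - (\<theta> \<and>\<^sub>\<Lambda> (y \<lrcorner> x \<lrcorner> \<alpha>)) vs"
    by (simp add: wedge_scale_right)
  have "(\<theta> \<and>\<^sub>\<Lambda> (y \<lrcorner> x \<lrcorner> \<alpha>)) vs = (\<Sum>l<length vs. \<theta> [vs ! l] * \<alpha> (x # vs[l := y]))"
  proof (cases k)
    case 0
    then show ?thesis using Cons.prems iprod_Lam_0[of \<alpha>] Lam_length[of \<alpha> 0] by simp
  next
    case (Suc k')
    then have "x \<lrcorner> \<alpha> \<in> Lam k'" using Cons.prems by blast
    from Cons.IH[OF this] show ?thesis by (simp add: iprod_def)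
  qed
  then show ?case
    unfolding wedge_Cons[OF assms(1)] 1 2 by (simp add: lessThan_Suc_eq_insert_0 sum.reindex)
qed

section \<open>One-forms, basis monomials and the model forms\<close>

lemma flat_simps [simp]: "flat X [] = 0" "flat X [v] = X \<bullet> v" "flat X (v # w # vs) = 0"
  by (simp_all add: flat_def)

lemma flat_Lam [simp, intro]: "flat X \<in> Lam 1"
proof -
  have "linear (\<lambda>v. flat X (v # vs))" for vs
    by (cases vs) (simp_all add: linear_zero linearI inner_add_right)
  then show ?thesis
    unfolding One_nat_def by (intro Lam_SucI) (auto simp: Lam_0_iff)
qed

lemma flat_wedge_Cons:
  "(flat X \<and>\<^sub>\<Lambda> \<beta>) (v # vs) = (X \<bullet> v) * \<beta> vs - (flat X \<and>\<^sub>\<Lambda> (v \<lrcorner> \<beta>)) vs"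
proof -
  have "v \<lrcorner> flat X \<in> Lam 0" by (auto simp: Lam_0_iff)
  then show ?thesis by (simp add: wedge_Cons[OF flat_Lam] wedge_Lam_0)
qed

lemma flat_wedge_Nil [simp]: "(flat X \<and>\<^sub>\<Lambda> \<beta>) [] = 0"
  by (simp add: wedge_Nil)

lemma form_one_Lam: "form_one \<in> Lam 0"
  by (simp add: Lam_0_iff form_one_def)

lemma wedge_form_one:
  assumes "\<alpha> \<in> Lam p"
  shows "\<alpha> \<and>\<^sub>\<Lambda> form_one = \<alpha>"
proof
  fix vs
  show "(\<alpha> \<and>\<^sub>\<Lambda> form_one) vs = \<alpha> vs"
    using assms
  proof (induction vs arbitrary: \<alpha> p)
    case Nil
    then show ?case by (simp add: wedge_Nil form_one_def)
  next
    case (Cons v vs)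
    have "(v \<lrcorner> \<alpha> \<and>\<^sub>\<Lambda> form_one) vs = (v \<lrcorner> \<alpha>) vs"
    proof (cases p)
      case 0
      then show ?thesis using iprod_Lam_0 Cons.prems by simp
    next
      case (Suc p')
      then show ?thesis using Cons.IH[OF Lam_iprod] Cons.prems by blast
    qed
    then show ?case
      by (simp add: wedge_Cons[OF Cons.prems] iprod_Lam_0[OF form_one_Lam])
  qed
qed

lemma ew_Cons: "ew (i # is) = flat (eb i) \<and>\<^sub>\<Lambda> ew is"
  by (simp add: ew_def)

lemma ew_Nil: "ew [] = form_one"
  by (simp add: ew_def)

lemma ew_singleton: "ew [i] = flat (eb i)"
  by (simp add: ew_Cons ew_Nil wedge_form_one[OF flat_Lam])

lemma ew_Lam: "length is = k \<Longrightarrow> ew is \<in> Lam k"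
proof (induction "is" arbitrary: k)
  case Nil
  then show ?case using form_one_Lam by (simp add: ew_Nil)
next
  case (Cons i "is")
  then show ?case using Lam_wedge[OF flat_Lam, of "ew is" "length is" "eb i"]
    by (auto simp: ew_Cons plus_1_eq_Suc)
qed

lemma vol_Lam: "vol \<in> Lam 8"
  unfolding vol_def by (rule ew_Lam) simp

lemma rho0_Lam: "rho0 \<in> Lam 3"
proof -
  have "\<omega> \<and>\<^sub>\<Lambda> ew [k] \<in> Lam (2 + 1)" if "\<omega> \<in> Lam 2" for \<omega> k
    using that by (intro Lam_wedge ew_Lam) (simp_all add: One_nat_def)
  then have w: "\<omega> \<and>\<^sub>\<Lambda> ew [k] \<in> Lam 3" if "\<omega> \<in> Lam 2" for \<omega> k
    using that by simp
  have e: "ew [i, j] \<in> Lam 2" "ew [i, j, k] \<in> Lam 3" for i j k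
    by (rule ew_Lam; simp)+
  show ?thesis
    unfolding rho0_def by (rule Lam_add Lam_diff Lam_scale w e)+
qed

section \<open>The orthonormal basis and expansions along it\<close>

lemma inner_eb: "x \<bullet> eb i = x $ of_nat i"
  by (simp add: eb_def inner_axis)

lemma inj_of_nat_8: "inj_on (of_nat :: nat \<Rightarrow> 8) {1..8}"
proof -
  have "{1..8::nat} = {1, 2, 3, 4, 5, 6, 7, 8}" by auto
  then show ?thesis by simp
qed

lemma range_of_nat_8: "(of_nat :: nat \<Rightarrow> 8) ` {1..8} = UNIV"
  by (rule card_subset_eq) (simp_all add: card_image[OF inj_of_nat_8])

lemma sum_UNIV_8: "(\<Sum>i\<in>UNIV. f (i :: 8)) = (\<Sum>i\<in>{1..8}. f (of_nat i))"
  unfolding range_of_nat_8[symmetric] by (simp add: sum.reindex[OF inj_of_nat_8])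

lemma eb_inner_eb:
  assumes "i \<in> {1..8}" "j \<in> {1..8}"
  shows "eb i \<bullet> eb j = (if i = j then 1 else 0)"
  using inj_onD[OF inj_of_nat_8 _ assms] by (auto simp: eb_def inner_axis_axis)

lemma eb_expansion: "x = (\<Sum>i\<in>{1..8}. (x \<bullet> eb i) *\<^sub>R eb i)"
  using basis_expansion[of x]
  by (simp add: sum_UNIV_8 inner_eb eb_def scalar_mult_eq_scaleR flip: inner_eb)

lemma linear_eb_expansion:
  assumes "linear \<phi>"
  shows "\<phi> x = (\<Sum>i\<in>{1..8}. (x \<bullet> eb i) *\<^sub>R \<phi> (eb i))"
  by (subst eb_expansion[of x]) (simp add: linear_sum[OF assms] linear_scale[OF assms])

lemma inner_eb_expansion: "x \<bullet> y = (\<Sum>i\<in>{1..8}. (x \<bullet> eb i) * (y \<bullet> eb i))"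
  by (simp add: inner_eb inner_vec_def[of x y] sum_UNIV_8)

text \<open>The induction keeps a prefix of basis vectors and expands the first remaining argument,
  so that arbitrary vectors are replaced from the left one at a time.\<close>

lemma form_zero_if_basis:
  assumes "\<alpha> \<in> Lam k"
    and "\<And>is. set is \<subseteq> {1..8} \<Longrightarrow> length is = k \<Longrightarrow> \<alpha> (map eb is) = 0"
  shows "\<alpha> = 0"
proof -
  have "\<alpha> (map eb is @ vs) = 0" if "set is \<subseteq> {1..8}" for "is" vs
    using that
  proof (induction vs arbitrary: "is")
    case Nil
    then show ?case using assms(2)[of "is"] Lam_length[OF assms(1), of "map eb is"]
      by (cases "length is = k") auto
  next
    case (Cons v vs)
    have "\<alpha> (map eb is @ eb i # vs) = 0" if "i \<in> {1..8}" for i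
      using Cons.IH[of "is @ [i]"] Cons.prems that by simp
    then show ?case
      using linear_eb_expansion[OF Lam_linear[OF assms(1), of "map eb is" vs], of v] by simp
  qed
  from this[of "[]"] show ?thesis by (simp add: fun_eq_iff)
qed

lemma Lam_9: "\<alpha> \<in> Lam 9 \<Longrightarrow> \<alpha> = 0"
proof (rule form_zero_if_basis)
  fix "is" :: "nat list"
  assume \<alpha>: "\<alpha> \<in> Lam 9" and "is": "set is \<subseteq> {1..8}" "length is = 9"
  have "card (set is) \<le> card {1..8::nat}" by (rule card_mono) (use "is" in auto)
  then have "\<not> distinct is" using "is" distinct_card[of "is"] by auto
  then obtain i j where "i < j" "j < length is" "is ! i = is ! j"
    by (metis distinct_conv_nth linorder_neqE_nat)
  then show "\<alpha> (map eb is) = 0" by (intro Lam_eq_zero[OF \<alpha>, of i j]) auto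
qed

section \<open>Endomorphisms acting on forms as derivations\<close>

lemma flat_adjoint:
  fixes A :: "vec8 \<Rightarrow> vec8"
  assumes "linear A"
  shows "flat (adjoint A y) [v] = A v \<bullet> y"
  using adjoint_works[OF assms, of v y] by (simp add: inner_commute)

lemma Lam_linear_update:
  assumes "\<alpha> \<in> Lam n" "l < length vs"
  shows "linear (\<lambda>v. \<alpha> (vs[l := v]))"
  using Lam_linear[OF assms(1), of "take l vs" "drop (Suc l) vs"] assms(2)
  by (simp add: upd_conv_take_nth_drop)

text \<open>Expanding \<open>A v\<close> in the basis writes \<open>A\<close> as a sum of rank-one
  maps, the coefficient of \<open>eb k\<close> being the 1-form dual to
  \<open>adjoint A (eb k)\<close>; \<open>wedge_iprod_right\<close> applies to each of them.\<close>

lemma derivation_eq_wedge: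
  assumes \<alpha>: "\<alpha> \<in> Lam n" and A: "linear A"
  shows "(\<Sum>l<length vs. \<alpha> (vs[l := A (vs ! l)])) =
    (\<Sum>k\<in>{1..8}. (flat (adjoint A (eb k)) \<and>\<^sub>\<Lambda> (eb k \<lrcorner> \<alpha>)) vs)"
proof -
  have "\<alpha> (vs[l := A (vs ! l)]) = (\<Sum>k\<in>{1..8}. flat (adjoint A (eb k)) [vs ! l] * \<alpha> (vs[l := eb k]))"
    if "l < length vs" for l
  proof -
    from linear_eb_expansion[OF Lam_linear_update[OF \<alpha> that], of "A (vs ! l)"] show ?thesis
      by (simp only: flat_adjoint[OF A] real_scaleR_def)
  qed
  then have "(\<Sum>l<length vs. \<alpha> (vs[l := A (vs ! l)])) =
      (\<Sum>l<length vs. \<Sum>k\<in>{1..8}. flat (adjoint A (eb k)) [vs ! l] * \<alpha> (vs[l := eb k]))"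
    by (intro sum.cong) auto
  also have "\<dots> = (\<Sum>k\<in>{1..8}. (flat (adjoint A (eb k)) \<and>\<^sub>\<Lambda> (eb k \<lrcorner> \<alpha>)) vs)"
    by (subst sum.swap) (simp only: wedge_iprod_right[OF flat_Lam \<alpha>])
  finally show ?thesis .
qed

text \<open>Skew maps have trace zero, so they annihilate the top forms; here this is a consequence of
  \<open>flat b \<and>\<^sub>\<Lambda> V\<close> being a 9-form.\<close>

lemma skew_derivation_top_form:
  assumes V: "V \<in> Lam 8" and A: "linear A" and skew: "\<And>x y. A x \<bullet> y = - (x \<bullet> A y)"
  shows "(\<Sum>l<length vs. V (vs[l := A (vs ! l)])) = 0"
proof -
  have self: "adjoint A x \<bullet> x = 0" for x
    using skew[of x x] adjoint_works[OF A, of x x] by (simp add: inner_commute)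
  have "flat b \<and>\<^sub>\<Lambda> V = 0" for b
    using Lam_wedge[OF flat_Lam V, of b] by (intro Lam_9) simp
  then have "(flat b \<and>\<^sub>\<Lambda> V) (y # vs) = 0" for b y by simp
  then have "(flat b \<and>\<^sub>\<Lambda> (y \<lrcorner> V)) vs = (b \<bullet> y) * V vs" for b y
    by (simp add: flat_wedge_Cons)
  then show ?thesis by (simp add: derivation_eq_wedge[OF V A] self)
qed

section \<open>Contractions and the Hodge operator as sums over the basis\<close>

lemma sum_lists_Suc:
  assumes "finite A"
  shows "(\<Sum>xs | set xs \<subseteq> A \<and> length xs = Suc k. f xs) =
    (\<Sum>a\<in>A. \<Sum>xs | set xs \<subseteq> A \<and> length xs = k. f (a # xs))"
proof -
  let ?L = "{xs. set xs \<subseteq> A \<and> length xs = k}"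
  have "(\<Sum>xs | set xs \<subseteq> A \<and> length xs = Suc k. f xs) = (\<Sum>z\<in>A \<times> ?L. f (fst z # snd z))"
    by (rule sum.reindex_bij_witness[of _ "\<lambda>z. fst z # snd z" "\<lambda>xs. (hd xs, tl xs)"])
      (auto simp: length_Suc_conv)
  then show ?thesis by (simp add: sum.cartesian_product case_prod_beta)
qed

lemma sum_lists_0: "(\<Sum>xs | set xs \<subseteq> A \<and> length xs = 0. f xs) = f []"
proof -
  have "{xs. set xs \<subseteq> A \<and> length xs = 0} = {[]}" by auto
  then show ?thesis by simp
qed

context
  fixes h :: "'b list \<Rightarrow> 'c"
  assumes adjacent: "\<And>us x y vs. h (us @ x # y # vs) = h (us @ y # x # vs)"
begin

lemma symmetric_fun_to_front: "h (us @ as @ x # bs) = h (us @ x # as @ bs)"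
proof (induction as arbitrary: us)
  case (Cons a as)
  from Cons.IH[of "us @ [a]"] show ?case using adjacent[of us a x "as @ bs"] by simp
qed simp

text \<open>Adjacent transpositions generate all permutations. The prefix \<open>us\<close> makes
  the induction on \<open>xs\<close> go through.\<close>

lemma symmetric_fun_mset: "mset xs = mset ys \<Longrightarrow> h (us @ xs) = h (us @ ys)"
proof (induction xs arbitrary: us ys)
  case (Cons x xs)
  then have "x \<in> set ys" by (metis list.set_intros(1) set_mset_mset)
  then obtain as bs where ys: "ys = as @ x # bs" by (meson split_list)
  then have "mset xs = mset (as @ bs)" using Cons.prems by simp
  from Cons.IH[OF this, of "us @ [x]"] show ?case
    by (simp add: ys symmetric_fun_to_front)
qed simp

end

text \<open>Contraction and Hodge operator are defined by sums over increasing indices, but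
  relabelling and swapping need independent indices. Each \<open>k\<close>-subset has
  \<open>k!\<close> orderings with equal value, and lists with a repetition contribute
  nothing.\<close>

lemma sum_lists_eq_sum_subsets:
  fixes h :: "'b::linorder list \<Rightarrow> 'c::comm_semiring_1"
  assumes "finite A"
    and adjacent: "\<And>us x y vs. h (us @ x # y # vs) = h (us @ y # x # vs)"
    and repeated: "\<And>xs. \<not> distinct xs \<Longrightarrow> h xs = 0"
  shows "(\<Sum>xs | set xs \<subseteq> A \<and> length xs = k. h xs) =
    of_nat (fact k) * (\<Sum>I | I \<subseteq> A \<and> card I = k. h (sorted_list_of_set I))"
proof -
  let ?J = "{I. I \<subseteq> A \<and> card I = k}"
  have fin: "finite I" if "I \<in> ?J" for I using that assms(1) finite_subset by blast
  have eq: "{xs. set xs \<subseteq> A \<and> length xs = k \<and> distinct xs} = (\<Union>I\<in>?J. permutations_of_set I)"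
    by (auto simp: permutations_of_set_def distinct_card)
  have "(\<Sum>xs | set xs \<subseteq> A \<and> length xs = k. h xs) =
      (\<Sum>xs | set xs \<subseteq> A \<and> length xs = k \<and> distinct xs. h xs)"
    by (rule sum.mono_neutral_right) (auto simp: finite_lists_length_eq[OF assms(1)] repeated)
  also have "\<dots> = (\<Sum>I\<in>?J. \<Sum>xs\<in>permutations_of_set I. h xs)"
    unfolding eq using assms(1) by (intro sum.UNION_disjoint) (auto dest: permutations_of_setD)
  also have "\<dots> = (\<Sum>I\<in>?J. of_nat (fact k) * h (sorted_list_of_set I))"
  proof (rule sum.cong)
    fix I assume I: "I \<in> ?J"
    have "h xs = h (sorted_list_of_set I)" if "xs \<in> permutations_of_set I" for xs
    proof -
      have "mset xs = mset (sorted_list_of_set I)"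
        using that fin[OF I] by (simp add: permutations_of_set_def set_eq_iff_mset_eq_distinct[symmetric])
      from symmetric_fun_mset[of h, OF adjacent this, of "[]"] show ?thesis by simp
    qed
    then show "(\<Sum>xs\<in>permutations_of_set I. h xs) = of_nat (fact k) * h (sorted_list_of_set I)"
      using I fin[OF I] by simp
  qed simp
  finally show ?thesis by (simp add: sum_distrib_left)
qed

text \<open>Permuting the common basis arguments changes both factors by the same sign, so their
  product is symmetric. The second claim absorbs the reversed order in which iterated contractions
  fill the slots.\<close>

lemma sum_basis_lists:
  fixes vs :: "vec8 list"
  assumes \<alpha>: "\<alpha> \<in> Lam k" and \<beta>: "\<beta> \<in> Lam n"
  defines "h \<equiv> \<lambda>xs. \<alpha> (map eb xs) * \<beta> (map eb xs @ vs)"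
  shows "(\<Sum>xs | set xs \<subseteq> {1..8} \<and> length xs = k. h xs) =
      fact k * (\<Sum>I | I \<subseteq> {1..8} \<and> card I = k. h (sorted_list_of_set I))"
    and "h (rev xs) = h xs"
proof -
  have adj: "h (us @ x # y # zs) = h (us @ y # x # zs)" for us x y zs
    using Lam_swap[OF \<alpha>, of "map eb us" "eb x" "[]" "eb y" "map eb zs"]
      Lam_swap[OF \<beta>, of "map eb us" "eb x" "[]" "eb y" "map eb zs @ vs"]
    by (simp add: h_def)
  have "h xs = 0" if "\<not> distinct xs" for xs
  proof -
    from that obtain i j where "i < j" "j < length xs" "xs ! i = xs ! j"
      by (metis distinct_conv_nth linorder_neqE_nat)
    then show ?thesis using Lam_eq_zero[OF \<alpha>, of i j "map eb xs"] by (simp add: h_def)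
  qed
  from sum_lists_eq_sum_subsets[of _ h, OF _ adj this, of "{1..8}" k]
  show "(\<Sum>xs | set xs \<subseteq> {1..8} \<and> length xs = k. h xs) =
      fact k * (\<Sum>I | I \<subseteq> {1..8} \<and> card I = k. h (sorted_list_of_set I))" by simp
  show "h (rev xs) = h xs"
    using symmetric_fun_mset[of h "rev xs" xs "[]", OF adj] by simp
qed

lemma Lam_append:
  assumes "\<alpha> \<in> Lam (length ws + k)"
  shows "(\<lambda>vs. \<alpha> (ws @ vs)) \<in> Lam k"
  using assms
proof (induction ws arbitrary: \<alpha>)
  case Nil
  then show ?case by simp
next
  case (Cons w ws)
  then have "w \<lrcorner> \<alpha> \<in> Lam (length ws + k)" by (intro Lam_iprod) simp
  from Cons.IH[OF this] show ?case by simp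
qed

text \<open>The innermost contraction fills the first slot, hence the reversal.\<close>

lemma iprods_eq: "iprods is \<alpha> = (\<lambda>vs. \<alpha> (rev (map eb is) @ vs))"
  by (induction "is" arbitrary: \<alpha>) (auto simp: iprods_def fun_eq_iff)

lemma sigma_op_eq:
  assumes "\<alpha> \<in> Lam k"
  shows "sigma_op k \<alpha> \<beta> = (\<Sum>I | I \<subseteq> {1..8} \<and> card I = k.
    \<alpha> (rev (map eb (sorted_list_of_set I))) \<cdot> iprods (sorted_list_of_set I) \<beta>)"
  unfolding sigma_op_def
proof (rule sum.cong)
  fix I :: "nat set" assume "I \<in> {I. I \<subseteq> {1..8} \<and> card I = k}"
  then have "iprods (sorted_list_of_set I) \<alpha> \<in> Lam 0"
    using assms unfolding iprods_eq by (intro Lam_append) simp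
  then show "iprods (sorted_list_of_set I) \<alpha> \<and>\<^sub>\<Lambda> iprods (sorted_list_of_set I) \<beta> =
      \<alpha> (rev (map eb (sorted_list_of_set I))) \<cdot> iprods (sorted_list_of_set I) \<beta>"
    by (simp add: wedge_Lam_0) (simp add: iprods_eq)
qed simp

lemma contr_Lam:
  assumes "\<alpha> \<in> Lam k" "\<beta> \<in> Lam (k + n)"
  shows "contr k \<alpha> \<beta> \<in> Lam n"
  unfolding sigma_op_eq[OF assms(1)]
proof (intro Lam_sum Lam_scale)
  fix I :: "nat set" assume "I \<in> {I. I \<subseteq> {1..8} \<and> card I = k}"
  then show "iprods (sorted_list_of_set I) \<beta> \<in> Lam n"
    using assms unfolding iprods_eq by (intro Lam_append) simp
qed

text \<open>Both factors of \<open>contr\<close> receive the basis vectors in reversed order, so the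
  two signs cancel; \<open>fact k\<close> passes from increasing to arbitrary indices.\<close>

lemma contr_eq_sum_lists:
  assumes \<alpha>: "\<alpha> \<in> Lam k" and \<beta>: "\<beta> \<in> Lam n"
  shows "fact k * contr k \<alpha> \<beta> vs =
    (\<Sum>xs | set xs \<subseteq> {1..8} \<and> length xs = k. \<alpha> (map eb xs) * \<beta> (map eb xs @ vs))"
  unfolding sum_basis_lists(1)[OF \<alpha> \<beta>] sigma_op_eq[OF \<alpha>] form_sum_apply
  using sum_basis_lists(2)[OF \<alpha> \<beta>] by (simp add: iprods_eq rev_map)

lemma contr_1:
  assumes "\<alpha> \<in> Lam 1" "\<beta> \<in> Lam n"
  shows "contr 1 \<alpha> \<beta> vs = (\<Sum>a\<in>{1..8}. \<alpha> [eb a] * \<beta> (eb a # vs))"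
  using contr_eq_sum_lists[OF assms, of vs]
  by (simp add: sum_lists_Suc sum_lists_0 One_nat_def del: length_0_conv)

lemma contr_2:
  assumes "\<alpha> \<in> Lam 2" "\<beta> \<in> Lam n"
  shows "2 * contr 2 \<alpha> \<beta> vs =
    (\<Sum>a\<in>{1..8}. \<Sum>b\<in>{1..8}. \<alpha> [eb a, eb b] * \<beta> (eb a # eb b # vs))"
  using contr_eq_sum_lists[OF assms, of vs]
  by (simp add: sum_lists_Suc sum_lists_0 numeral_2_eq_2 del: length_0_conv)

lemma contr_3:
  assumes "\<alpha> \<in> Lam 3" "\<beta> \<in> Lam n"
  shows "6 * contr 3 \<alpha> \<beta> vs = (\<Sum>a\<in>{1..8}. \<Sum>b\<in>{1..8}. \<Sum>c\<in>{1..8}.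
    \<alpha> [eb a, eb b, eb c] * \<beta> (eb a # eb b # eb c # vs))"
  using contr_eq_sum_lists[OF assms, of vs]
  by (simp add: sum_lists_Suc sum_lists_0 numeral_3_eq_3 del: length_0_conv)

lemma hodge_eq:
  assumes "\<alpha> \<in> Lam k"
  shows "hodge \<alpha> = (\<Sum>I | I \<subseteq> {1..8} \<and> card I = k. \<alpha> (map eb (sorted_list_of_set I)) \<cdot>
    (\<lambda>vs. vol (map eb (sorted_list_of_set I) @ vs)))"
proof
  fix vs
  show "hodge \<alpha> vs = (\<Sum>I | I \<subseteq> {1..8} \<and> card I = k. \<alpha> (map eb (sorted_list_of_set I)) \<cdot>
    (\<lambda>vs. vol (map eb (sorted_list_of_set I) @ vs))) vs"
    unfolding hodge_def form_sum_apply
    by (rule sum.mono_neutral_cong_right) (auto intro!: Lam_length[OF assms])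
qed

lemma hodge_Lam:
  assumes "\<alpha> \<in> Lam k" "k + n = 8"
  shows "hodge \<alpha> \<in> Lam n"
  unfolding hodge_eq[OF assms(1)]
proof (intro Lam_sum Lam_scale)
  fix I :: "nat set" assume "I \<in> {I. I \<subseteq> {1..8} \<and> card I = k}"
  then show "(\<lambda>vs. vol (map eb (sorted_list_of_set I) @ vs)) \<in> Lam n"
    using assms(2) vol_Lam by (intro Lam_append) simp
qed

lemma hodge_4:
  assumes "\<alpha> \<in> Lam 4"
  shows "24 * hodge \<alpha> vs = (\<Sum>a\<in>{1..8}. \<Sum>b\<in>{1..8}. \<Sum>c\<in>{1..8}. \<Sum>d\<in>{1..8}.
    \<alpha> [eb a, eb b, eb c, eb d] * vol (eb a # eb b # eb c # eb d # vs))"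
proof -
  have "24 * hodge \<alpha> vs = (\<Sum>xs | set xs \<subseteq> {1..8} \<and> length xs = 4.
      \<alpha> (map eb xs) * vol (map eb xs @ vs))"
    unfolding sum_basis_lists(1)[OF assms vol_Lam] hodge_eq[OF assms] form_sum_apply
    by (simp add: fact_numeral)
  moreover have "4 = Suc (Suc (Suc (Suc 0)))" by simp
  ultimately show ?thesis
    by (simp add: sum_lists_Suc sum_lists_0 del: length_0_conv)
qed

section \<open>The Lie bracket of \<open>rho0\<close>\<close>

lemma Lam_2_iprod:
  assumes "\<omega> \<in> Lam 2"
  shows "v \<lrcorner> \<omega> \<in> Lam 1" "w \<lrcorner> v \<lrcorner> \<omega> \<in> Lam 0"
  using assms Lam_iprod[of \<omega> 1 v] Lam_iprod[of "v \<lrcorner> \<omega>" 0 w]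
  by (simp_all add: One_nat_def numeral_2_eq_2)

lemma Lam_3_iprod: "\<alpha> \<in> Lam 3 \<Longrightarrow> v \<lrcorner> \<alpha> \<in> Lam 2"
  using Lam_iprod[of \<alpha> 2 v] by (simp add: numeral_3_eq_3 numeral_2_eq_2)

lemma wedge_1_Cons:
  assumes "\<theta> \<in> Lam 1"
  shows "(\<theta> \<and>\<^sub>\<Lambda> \<beta>) (v # vs) = \<theta> [v] * \<beta> vs - (\<theta> \<and>\<^sub>\<Lambda> (v \<lrcorner> \<beta>)) vs"
  using wedge_Cons[OF assms] wedge_Lam_0[of "v \<lrcorner> \<theta>"] Lam_iprod[of \<theta> 0 v] assms
  by (simp add: One_nat_def)

lemma wedge_1_Nil: "\<theta> \<in> Lam 1 \<Longrightarrow> (\<theta> \<and>\<^sub>\<Lambda> \<beta>) [] = 0"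
  using Lam_length[of \<theta> 1 "[]"] by (simp add: wedge_Nil)

lemma wedge_2_Cons:
  "\<omega> \<in> Lam 2 \<Longrightarrow> (\<omega> \<and>\<^sub>\<Lambda> \<beta>) (v # vs) = (v \<lrcorner> \<omega> \<and>\<^sub>\<Lambda> \<beta>) vs + (\<omega> \<and>\<^sub>\<Lambda> (v \<lrcorner> \<beta>)) vs"
  by (simp add: wedge_Cons)

lemma wedge_2_Nil: "\<omega> \<in> Lam 2 \<Longrightarrow> (\<omega> \<and>\<^sub>\<Lambda> \<beta>) [] = 0"
  using Lam_length[of \<omega> 2 "[]"] by (simp add: wedge_Nil)

lemma wedge_2_1:
  assumes "\<omega> \<in> Lam 2"
  shows "(\<omega> \<and>\<^sub>\<Lambda> flat a) [x, y, z] = \<omega> [x, y] * (a \<bullet> z) - \<omega> [x, z] * (a \<bullet> y) + \<omega> [y, z] * (a \<bullet> x)"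
proof -
  have "(v \<lrcorner> \<omega> \<and>\<^sub>\<Lambda> \<beta>) (w # vs) = \<omega> [v, w] * \<beta> vs - (v \<lrcorner> \<omega> \<and>\<^sub>\<Lambda> (w \<lrcorner> \<beta>)) vs" for v w \<beta> vs
    using wedge_1_Cons[OF Lam_2_iprod(1)[OF assms], of v \<beta> w vs] by simp
  then show ?thesis
    using wedge_1_Nil[OF Lam_2_iprod(1)[OF assms]] wedge_2_Nil[OF assms]
    by (simp add: wedge_2_Cons[OF assms] del: iprod_apply)
      (simp add: iprod_def flat_def)
qed

lemma wedge_2_2:
  assumes "\<omega> \<in> Lam 2"
  shows "(\<omega> \<and>\<^sub>\<Lambda> \<beta>) [p, q, r, s] =
    \<omega> [p, q] * \<beta> [r, s] - \<omega> [p, r] * \<beta> [q, s] + \<omega> [p, s] * \<beta> [q, r] +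
    \<omega> [q, r] * \<beta> [p, s] - \<omega> [q, s] * \<beta> [p, r] + \<omega> [r, s] * \<beta> [p, q]"
proof -
  have "(v \<lrcorner> \<omega> \<and>\<^sub>\<Lambda> \<beta>) (w # vs) = \<omega> [v, w] * \<beta> vs - (v \<lrcorner> \<omega> \<and>\<^sub>\<Lambda> (w \<lrcorner> \<beta>)) vs" for v w \<beta> vs
    using wedge_1_Cons[OF Lam_2_iprod(1)[OF assms], of v \<beta> w vs] by simp
  then show ?thesis
    using wedge_1_Nil[OF Lam_2_iprod(1)[OF assms]] wedge_2_Nil[OF assms]
    by (simp add: wedge_2_Cons[OF assms] del: iprod_apply) (simp add: iprod_def)
qed

text \<open>\<open>e i j k\<close> is the 3 by 3 determinant of the coordinates \<open>i\<close>,
  \<open>j\<close>, \<open>k\<close> of the three vectors, expanded by cofactors; it is the value of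
  the monomial \<open>ew [i, j, k]\<close>.\<close>

lemma rho0_explicit:
  "rho0 [x, y, z] =
    (let e = \<lambda>i j k. x $ i * (y $ j * z $ k - z $ j * y $ k) - y $ i * (x $ j * z $ k - z $ j * x $ k)
        + z $ i * (x $ j * y $ k - y $ j * x $ k)
     in e 2 4 6 - e 2 3 5 - e 1 4 5 - e 1 3 6 + e 1 2 7 + e 3 4 7 - 2 * e 5 6 7
       + sqrt 3 * (e 1 2 8 - e 3 4 8))"
proof -
  have e2: "ew [i, j] \<in> Lam 2" for i j
    by (rule ew_Lam) simp
  have \<omega>: "ew [1, 2] + ew [3, 4] - 2 \<cdot> ew [5, 6] \<in> Lam 2" "ew [1, 2] - ew [3, 4] \<in> Lam 2"
    by (rule Lam_add Lam_diff Lam_scale e2)+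
  have [simp]: "eb i \<bullet> v = v $ of_nat i" for i v
    using inner_eb[of v i] by (simp add: inner_commute)
  have 2: "ew [i, j] [v, w] = v $ of_nat i * w $ of_nat j - w $ of_nat i * v $ of_nat j" for i j v w
    by (simp add: ew_Cons[of i] ew_singleton flat_wedge_Cons)
  have 3: "ew [i, j, k] [u, v, w] = u $ of_nat i * ew [j, k] [v, w] - v $ of_nat i * ew [j, k] [u, w]
      + w $ of_nat i * ew [j, k] [u, v]" for i j k u v w
    by (simp add: ew_Cons[of i] flat_wedge_Cons)
  show ?thesis
    unfolding rho0_def ew_singleton
    by (simp add: wedge_2_1[OF \<omega>(1)] wedge_2_1[OF \<omega>(2)] 2 3 Let_def) (simp add: algebra_simps)
qed

text \<open>Each summand, summed over \<open>k\<close>, is an inner product such as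
  \<open>bracket x q \<bullet> bracket a b\<close>, which by invariance of \<open>rho0\<close>
  equals \<open>x \<bullet> bracket q (bracket a b)\<close>. The sum is thus the inner product of
  \<open>x\<close> with the Jacobi expression of \<open>q\<close>, \<open>a\<close>,
  \<open>b\<close>.\<close>

lemma rho0_jacobi:
  "(\<Sum>k\<in>{1..8}. rho0 [x, q, eb k] * rho0 [a, b, eb k] + rho0 [x, a, eb k] * rho0 [b, q, eb k]
      + rho0 [x, b, eb k] * rho0 [q, a, eb k]) = 0"
proof -
  have s: "sqrt 3 * sqrt 3 = 3" "sqrt 3 * (sqrt 3 * t) = 3 * t" for t :: real
    by (simp_all flip: mult.assoc)
  have eb: "eb k $ j = (if of_nat k = j then 1 else 0)" for k j
    by (auto simp: eb_def axis_def)
  have set: "{1..8::nat} = {1, 2, 3, 4, 5, 6, 7, 8}" by auto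
  note e = rho0_explicit[unfolded Let_def]
  \<comment> \<open>The eight components of the bracket of \<open>v\<close> and \<open>w\<close>,
    read off from the coordinate formula.\<close>
  have c:
    "rho0 [v, w, eb 1] = - (v $ 4 * w $ 5 - w $ 4 * v $ 5) - (v $ 3 * w $ 6 - w $ 3 * v $ 6) + (v $ 2 * w $ 7 - w $ 2 * v $ 7) + sqrt 3 * (v $ 2 * w $ 8 - w $ 2 * v $ 8)"
    "rho0 [v, w, eb 2] = (v $ 4 * w $ 6 - w $ 4 * v $ 6) - (v $ 3 * w $ 5 - w $ 3 * v $ 5) + (v $ 7 * w $ 1 - w $ 7 * v $ 1) + sqrt 3 * (v $ 8 * w $ 1 - w $ 8 * v $ 1)"
    "rho0 [v, w, eb 3] = - (v $ 5 * w $ 2 - w $ 5 * v $ 2) - (v $ 6 * w $ 1 - w $ 6 * v $ 1) + (v $ 4 * w $ 7 - w $ 4 * v $ 7) - sqrt 3 * (v $ 4 * w $ 8 - w $ 4 * v $ 8)"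
    "rho0 [v, w, eb 4] = (v $ 6 * w $ 2 - w $ 6 * v $ 2) - (v $ 5 * w $ 1 - w $ 5 * v $ 1) + (v $ 7 * w $ 3 - w $ 7 * v $ 3) - sqrt 3 * (v $ 8 * w $ 3 - w $ 8 * v $ 3)"
    "rho0 [v, w, eb 5] = - (v $ 2 * w $ 3 - w $ 2 * v $ 3) - (v $ 1 * w $ 4 - w $ 1 * v $ 4) - 2 * (v $ 6 * w $ 7 - w $ 6 * v $ 7)"
    "rho0 [v, w, eb 6] = (v $ 2 * w $ 4 - w $ 2 * v $ 4) - (v $ 1 * w $ 3 - w $ 1 * v $ 3) - 2 * (v $ 7 * w $ 5 - w $ 7 * v $ 5)"
    "rho0 [v, w, eb 7] = (v $ 1 * w $ 2 - w $ 1 * v $ 2) + (v $ 3 * w $ 4 - w $ 3 * v $ 4) - 2 * (v $ 5 * w $ 6 - w $ 5 * v $ 6)"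
    "rho0 [v, w, eb 8] = sqrt 3 * (v $ 1 * w $ 2 - w $ 1 * v $ 2) - sqrt 3 * (v $ 3 * w $ 4 - w $ 3 * v $ 4)"
    for v w
    by (simp_all add: e eb) (simp_all add: algebra_simps)
  let ?J = "\<lambda>x. \<Sum>k\<in>{1..8}. rho0 [x, q, eb k] * rho0 [a, b, eb k] + rho0 [x, a, eb k] * rho0 [b, q, eb k]
      + rho0 [x, b, eb k] * rho0 [q, a, eb k]"
  have lin: "linear (\<lambda>x. rho0 [x, y, z])" for y z
    using Lam_linear[OF rho0_Lam, of "[]" "[y, z]"] by simp
  have "linear (\<lambda>x. rho0 [x, y, z] * t)" for y z t
    by (rule linearI) (simp_all add: linear_add[OF lin] linear_scale[OF lin] distrib_right)
  then have "linear ?J"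
    by (intro linear_compose_sum ballI linear_compose_add)
  \<comment> \<open>Linearity in \<open>x\<close> leaves eight polynomial identities in the
    coordinates of \<open>q\<close>, \<open>a\<close>, \<open>b\<close>; the square root enters them
    only through its square, via \<open>s\<close>.\<close>
  have "?J (eb i) = 0" if i: "i \<in> {1, 2, 3, 4, 5, 6, 7, 8}" for i
    using i unfolding set by (elim insertE emptyE) (simp_all add: c eb, simp_all add: algebra_simps s)
  then show ?thesis
    using linear_eb_expansion[OF \<open>linear ?J\<close>, of x] unfolding set by simp
qed

definition bracket :: "vec8 \<Rightarrow> vec8 \<Rightarrow> vec8" where
  "bracket x y = (\<Sum>k\<in>{1..8}. rho0 [x, y, eb k] *\<^sub>R eb k)"

lemma inner_bracket: "bracket x y \<bullet> z = rho0 [x, y, z]"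
proof -
  have "linear (\<lambda>z. rho0 [x, y, z])" using Lam_linear[OF rho0_Lam, of "[x, y]" "[]"] by simp
  from linear_eb_expansion[OF this, of z] show ?thesis
    by (simp add: bracket_def inner_sum_left inner_commute[of z] mult.commute)
qed

lemma linear_bracket: "linear (\<lambda>x. bracket x y)"
proof -
  have lin: "linear (\<lambda>x. rho0 [x, y, z])" for z
    using Lam_linear[OF rho0_Lam, of "[]" "[y, z]"] by simp
  show ?thesis
    by (rule linearI)
      (simp_all add: bracket_def linear_add[OF lin] linear_scale[OF lin] scaleR_left_distrib
        sum.distrib scaleR_sum_right)
qed

lemma bracket_skew: "bracket x a \<bullet> y = - (x \<bullet> bracket y a)"
  using Lam_swap[OF rho0_Lam, of "[]" x "[a]" y "[]"] inner_bracket[of x a y] inner_bracket[of y a x]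
  by (simp add: inner_commute[of x])

lemma bracket_self: "bracket x x = 0"
  using Lam_alternating[OF rho0_Lam, of "[]" x "[]"] by (simp add: bracket_def)

text \<open>The three adjacent transpositions of the summation indices generate all the relabellings
  used later.\<close>

lemma sum_permute_4:
  fixes I :: "'b set" and f :: "'b \<Rightarrow> 'b \<Rightarrow> 'b \<Rightarrow> 'b \<Rightarrow> real"
  defines "S \<equiv> \<lambda>f :: 'b \<Rightarrow> 'b \<Rightarrow> 'b \<Rightarrow> 'b \<Rightarrow> real. \<Sum>p\<in>I. \<Sum>q\<in>I. \<Sum>r\<in>I. \<Sum>s\<in>I. f p q r s"
  shows "S (\<lambda>p q r s. f q p r s) = S f"
    and "S (\<lambda>p q r s. f r q p s) = S f"
    and "S (\<lambda>p q r s. f s q r p) = S f"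
    and "S (\<lambda>p q r s. f p r q s) = S f"
    and "S (\<lambda>p q r s. f p q s r) = S f"
    and "S (\<lambda>p q r s. f p s q r) = S f"
    and "S (\<lambda>p q r s. f p r s q) = S f"
    and "S (\<lambda>p q r s. f r s p q) = S f"
    and "S (\<lambda>p q r s. f q r s p) = S f"
proof -
  have swaps: "S (\<lambda>p q r s. f q p r s) = S f" "S (\<lambda>p q r s. f p r q s) = S f"
    "S (\<lambda>p q r s. f p q s r) = S f" for f
    unfolding S_def by (subst sum.swap, rule refl)+
  show "S (\<lambda>p q r s. f q p r s) = S f"
    and "S (\<lambda>p q r s. f r q p s) = S f"
    and "S (\<lambda>p q r s. f s q r p) = S f"
    and "S (\<lambda>p q r s. f p r q s) = S f"
    and "S (\<lambda>p q r s. f p q s r) = S f"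
    and "S (\<lambda>p q r s. f p s q r) = S f"
    and "S (\<lambda>p q r s. f p r s q) = S f"
    and "S (\<lambda>p q r s. f r s p q) = S f"
    and "S (\<lambda>p q r s. f q r s p) = S f"
    using swaps by metis+
qed

lemma bracket_eb_slot:
  assumes "V \<in> Lam n"
  shows "V (bracket x y # vs) = (\<Sum>k\<in>{1..8}. rho0 [x, y, eb k] * V (eb k # vs))"
proof -
  have lin: "linear (\<lambda>z. V (z # vs))" using Lam_linear[OF assms, of "[]" vs] by simp
  show ?thesis by (simp add: bracket_def linear_sum[OF lin] linear_scale[OF lin])
qed

lemma rho0_swap:
  "rho0 [y, x, z] = - rho0 [x, y, z]" "rho0 [x, z, y] = - rho0 [x, y, z]"
  using Lam_swap[OF rho0_Lam, of "[]" y "[]" x "[z]"] Lam_swap[OF rho0_Lam, of "[x]" z "[]" y "[]"]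
  by simp_all

lemma sigma_op_1: "sigma_op 1 \<alpha> \<beta> = (\<Sum>i\<in>{1..8}. (eb i \<lrcorner> \<alpha>) \<and>\<^sub>\<Lambda> (eb i \<lrcorner> \<beta>))"
proof -
  have "{I. I \<subseteq> {1..8} \<and> card I = 1} = (\<lambda>i. {i}) ` {1..8::nat}"
    by (auto elim!: card_1_singletonE)
  then show ?thesis by (simp add: sigma_op_def sum.reindex iprods_def)
qed

section \<open>The bracket acting on one slot of a top form\<close>

context
  fixes V :: form and u v w :: vec8
  assumes V: "V \<in> Lam 8"
begin

text \<open>Such terms arise when the skew map \<open>\<lambda>x. bracket x (eb a)\<close> acts on
  one of the first four slots of \<open>V [eb p, eb q, eb r, eb s, eb a, u, v, w]\<close> and that
  slot is moved to the front.\<close>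

definition "bracket_top p q r s a = V [bracket (eb p) (eb a), eb q, eb r, eb s, eb a, u, v, w]"

lemma bracket_top_swap:
  "bracket_top p r q s a = - bracket_top p q r s a"
  "bracket_top p q s r a = - bracket_top p q r s a"
  unfolding bracket_top_def
  subgoal using Lam_swap[OF V, of "[bracket (eb p) (eb a)]" "eb r" "[]" "eb q"] by simp
  subgoal using Lam_swap[OF V, of "[bracket (eb p) (eb a), eb q]" "eb s" "[]" "eb r"] by simp
  done

lemma bracket_top_eq:
  "bracket_top p q r s a = (\<Sum>x\<in>{1..8}. rho0 [eb p, eb a, eb x] * V [eb x, eb q, eb r, eb s, eb a, u, v, w])"
  unfolding bracket_top_def by (rule bracket_eb_slot[OF V])

text \<open>After expansion of the bracket, \<open>V\<close> is alternating in the slots of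
  \<open>eb q\<close>, \<open>eb a\<close>, \<open>eb x\<close>. It is therefore invariant under
  their cyclic rotation, and only the cyclic sum of the coefficient \<open>K\<close> counts, which
  is a Jacobi sum.\<close>

lemma bracket_top_jacobi:
  "(\<Sum>p\<in>{1..8}. \<Sum>q\<in>{1..8}. \<Sum>a\<in>{1..8}. rho0 [eb i, eb p, eb q] * bracket_top p q r s a) = 0"
proof -
  define K where "K q a x = (\<Sum>p\<in>{1..8}. rho0 [eb i, eb p, eb q] * rho0 [eb p, eb a, eb x])" for q a x
  define W where "W q a x = V [eb x, eb q, eb r, eb s, eb a, u, v, w]" for q a x
  define S where "S f = (\<Sum>q\<in>{1..8::nat}. \<Sum>a\<in>{1..8::nat}. \<Sum>x\<in>{1..8::nat}. f q a x :: real)" for f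
  have S_rot: "S (\<lambda>q a x. f a x q) = S f" for f
    unfolding S_def by (subst sum.swap) (rule sum.cong, simp, rule sum.swap)
  have W_rot: "W a x q = W q a x" for q a x
    using Lam_swap[OF V, of "[]" "eb q" "[]" "eb a" "[eb r, eb s, eb x, u, v, w]"]
      Lam_swap[OF V, of "[]" "eb a" "[eb q, eb r, eb s]" "eb x" "[u, v, w]"]
    by (simp add: W_def)
  \<comment> \<open>Total antisymmetry moves the summation index \<open>p\<close> into the last slot
    of both factors, at the cost of one overall sign; this is the shape of
    \<open>rho0_jacobi\<close>.\<close>
  have K_cyc: "K q a x + K a x q + K x q a = 0" for q a x
  proof -
    have "K q a x + K a x q + K x q a = (\<Sum>p\<in>{1..8}.
        rho0 [eb i, eb p, eb q] * rho0 [eb p, eb a, eb x] + rho0 [eb i, eb p, eb a] * rho0 [eb p, eb x, eb q]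
        + rho0 [eb i, eb p, eb x] * rho0 [eb p, eb q, eb a])"
      by (simp add: K_def sum.distrib)
    also have "\<dots> = - (\<Sum>k\<in>{1..8}. rho0 [eb i, eb q, eb k] * rho0 [eb a, eb x, eb k]
        + rho0 [eb i, eb a, eb k] * rho0 [eb x, eb q, eb k] + rho0 [eb i, eb x, eb k] * rho0 [eb q, eb a, eb k])"
      unfolding sum_negf[symmetric]
    proof (rule sum.cong)
      fix p
      have rot: "rho0 [eb p, y, z] = rho0 [y, z, eb p]" for y z
        using rho0_swap(1)[of "eb p" y z] rho0_swap(2)[of y "eb p" z] by simp
      show "rho0 [eb i, eb p, eb q] * rho0 [eb p, eb a, eb x] + rho0 [eb i, eb p, eb a] * rho0 [eb p, eb x, eb q]
          + rho0 [eb i, eb p, eb x] * rho0 [eb p, eb q, eb a] =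
        - (rho0 [eb i, eb q, eb p] * rho0 [eb a, eb x, eb p] + rho0 [eb i, eb a, eb p] * rho0 [eb x, eb q, eb p]
          + rho0 [eb i, eb x, eb p] * rho0 [eb q, eb a, eb p])"
        unfolding rho0_swap(2)[of "eb i" "eb q" "eb p"] rho0_swap(2)[of "eb i" "eb a" "eb p"]
          rho0_swap(2)[of "eb i" "eb x" "eb p"] rot[of "eb a"] rot[of "eb x"] rot[of "eb q"]
        by simp
    qed simp
    finally show ?thesis by (simp only: rho0_jacobi)
  qed
  have "(\<Sum>p\<in>{1..8}. \<Sum>q\<in>{1..8}. \<Sum>a\<in>{1..8}. rho0 [eb i, eb p, eb q] * bracket_top p q r s a) =
      (\<Sum>p\<in>{1..8}. S (\<lambda>q a x. rho0 [eb i, eb p, eb q] * rho0 [eb p, eb a, eb x] * W q a x))"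
    by (simp add: bracket_top_eq W_def S_def sum_distrib_left mult.assoc)
  also have "\<dots> = S (\<lambda>q a x. K q a x * W q a x)"
    unfolding S_def K_def sum_distrib_right
    by (subst sum.swap, rule sum.cong, simp, subst sum.swap, rule sum.cong, simp, rule sum.swap)
  finally have T: "(\<Sum>p\<in>{1..8}. \<Sum>q\<in>{1..8}. \<Sum>a\<in>{1..8}. rho0 [eb i, eb p, eb q] * bracket_top p q r s a) =
      S (\<lambda>q a x. K q a x * W q a x)" .
  have "S (\<lambda>q a x. K q a x * W q a x) = S (\<lambda>q a x. K a x q * W q a x)"
    "S (\<lambda>q a x. K q a x * W q a x) = S (\<lambda>q a x. K x q a * W q a x)"
    using S_rot[of "\<lambda>q a x. K q a x * W q a x"] S_rot[of "\<lambda>q a x. K a x q * W q a x"]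
    by (simp_all add: W_rot)
  \<comment> \<open>Three rotated copies of one sum are equal, so three times it carries the cyclic
    coefficient.\<close>
  then have "3 * S (\<lambda>q a x. K q a x * W q a x) =
      S (\<lambda>q a x. K q a x * W q a x) + S (\<lambda>q a x. K a x q * W q a x) + S (\<lambda>q a x. K x q a * W q a x)"
    by linarith
  also have "\<dots> = S (\<lambda>q a x. (K q a x + K a x q + K x q a) * W q a x)"
    by (simp add: S_def sum.distrib distrib_right)
  also have "\<dots> = 0" unfolding K_cyc by (simp add: S_def)
  finally show ?thesis using T by simp
qed

text \<open>Once the bracket is expanded, exchanging the index pairs \<open>(q, r)\<close> and
  \<open>(a, x)\<close> interchanges the roles of \<open>i\<close> and \<open>p\<close> in the two
  factors \<open>rho0\<close>. On \<open>V\<close> it acts by two transpositions, so no sign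
  appears.\<close>

lemma bracket_top_symmetric:
  "(\<Sum>q\<in>{1..8}. \<Sum>r\<in>{1..8}. \<Sum>a\<in>{1..8}. rho0 [eb i, eb q, eb r] * bracket_top p q r s a) =
   (\<Sum>q\<in>{1..8}. \<Sum>r\<in>{1..8}. \<Sum>a\<in>{1..8}. rho0 [eb p, eb q, eb r] * bracket_top i q r s a)"
proof -
  define W where "W q r a x = V [eb x, eb q, eb r, eb s, eb a, u, v, w]" for q r a x
  have W: "W a x q r = W q r a x" for q r a x
    using Lam_swap[OF V, of "[]" "eb r" "[eb a]" "eb x" "[eb s, eb q, u, v, w]"]
      Lam_swap[OF V, of "[eb x]" "eb a" "[eb r, eb s]" "eb q" "[u, v, w]"]
    by (simp add: W_def)
  have eq: "(\<Sum>q\<in>{1..8}. \<Sum>r\<in>{1..8}. \<Sum>a\<in>{1..8}. rho0 [eb i, eb q, eb r] * bracket_top p q r s a) =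
    (\<Sum>q\<in>{1..8}. \<Sum>r\<in>{1..8}. \<Sum>a\<in>{1..8}. \<Sum>x\<in>{1..8}.
      rho0 [eb i, eb q, eb r] * (rho0 [eb p, eb a, eb x] * W q r a x))" for i p
    by (simp add: bracket_top_eq W_def sum_distrib_left)
  show ?thesis
    unfolding eq
    by (subst sum_permute_4(8)[symmetric]) (simp add: W mult.left_commute)
qed

text \<open>Up to a factor this is \<open>hodge (sigma_plus (sigma_plus \<tau>)) [u, v, w]\<close>
  for \<open>V = vol\<close>, so it expresses that \<open>sigma_plus\<close> squares to
  zero.\<close>

lemma sum_alternating_bracket_top:
  assumes \<tau>: "\<tau> \<in> Lam 3"
  shows "(\<Sum>p\<in>{1..8}. \<Sum>q\<in>{1..8}. \<Sum>r\<in>{1..8}. \<Sum>s\<in>{1..8}. \<Sum>a\<in>{1..8}.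
    sigma_plus \<tau> [eb p, eb q, eb r, eb s] * bracket_top p q r s a) = 0"
proof -
  let ?I = "{1..8::nat}"
  define S where "S f = (\<Sum>p\<in>?I. \<Sum>q\<in>?I. \<Sum>r\<in>?I. \<Sum>s\<in>?I. f p q r s :: real)" for f
  \<comment> \<open>The six terms of the product of two 2-forms fall into two kinds: in
    \<open>X\<close> the index \<open>p\<close> sits in \<open>rho0\<close>, in \<open>Y\<close> it
    sits in \<tau>.\<close>
  define X Y :: "nat \<Rightarrow> nat \<Rightarrow> nat \<Rightarrow> nat \<Rightarrow> real"
    where "X p q r s = (\<Sum>a\<in>?I. \<Sum>i\<in>?I. rho0 [eb i, eb p, eb q] * \<tau> [eb i, eb r, eb s] * bracket_top p q r s a)"
      and "Y p q r s = (\<Sum>a\<in>?I. \<Sum>i\<in>?I. rho0 [eb i, eb q, eb r] * \<tau> [eb i, eb p, eb s] * bracket_top p q r s a)"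
    for p q r s
  have \<eta>: "sigma_plus \<tau> [eb p, eb q, eb r, eb s] = (\<Sum>i\<in>?I.
      rho0 [eb i, eb p, eb q] * \<tau> [eb i, eb r, eb s] - rho0 [eb i, eb p, eb r] * \<tau> [eb i, eb q, eb s]
      + rho0 [eb i, eb p, eb s] * \<tau> [eb i, eb q, eb r] + rho0 [eb i, eb q, eb r] * \<tau> [eb i, eb p, eb s]
      - rho0 [eb i, eb q, eb s] * \<tau> [eb i, eb p, eb r] + rho0 [eb i, eb r, eb s] * \<tau> [eb i, eb p, eb q])"
    for p q r s
    by (simp add: sigma_plus_def sigma_op_1 form_sum_apply wedge_2_2[OF Lam_3_iprod[OF rho0_Lam]])
  have "(\<Sum>p\<in>?I. \<Sum>q\<in>?I. \<Sum>r\<in>?I. \<Sum>s\<in>?I. \<Sum>a\<in>?I.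
      sigma_plus \<tau> [eb p, eb q, eb r, eb s] * bracket_top p q r s a) =
    S (\<lambda>p q r s. X p q r s + X p r q s + X p s q r + Y p q r s + Y p q s r + Y p r s q)"
  proof -
    have "sigma_plus \<tau> [eb p, eb q, eb r, eb s] * bracket_top p q r s a = (\<Sum>i\<in>?I.
        rho0 [eb i, eb p, eb q] * \<tau> [eb i, eb r, eb s] * bracket_top p q r s a
        + rho0 [eb i, eb p, eb r] * \<tau> [eb i, eb q, eb s] * bracket_top p r q s a
        + rho0 [eb i, eb p, eb s] * \<tau> [eb i, eb q, eb r] * bracket_top p s q r a
        + rho0 [eb i, eb q, eb r] * \<tau> [eb i, eb p, eb s] * bracket_top p q r s a
        + rho0 [eb i, eb q, eb s] * \<tau> [eb i, eb p, eb r] * bracket_top p q s r a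
        + rho0 [eb i, eb r, eb s] * \<tau> [eb i, eb p, eb q] * bracket_top p r s q a)" for p q r s a
      unfolding \<eta> sum_distrib_right bracket_top_swap(1)[of p r q s a] bracket_top_swap(2)[of p q s r a]
        bracket_top_swap(1)[of p s q r a] bracket_top_swap(2)[of p r s q a]
        bracket_top_swap(2)[of p q s r a] bracket_top_swap(1)[of p r q s a]
      by (simp add: algebra_simps)
    then show ?thesis by (simp add: S_def X_def Y_def sum.distrib)
  qed
  \<comment> \<open>Skewness of \<open>bracket_top\<close> in \<open>q\<close>, \<open>r\<close>,
    \<open>s\<close> absorbed the shuffle signs, so the three terms of each kind differ by
    relabelling only.\<close>
  also have "\<dots> = 3 * S X + 3 * S Y"
    using sum_permute_4(4,5,6,7)[of X ?I] sum_permute_4(4,5,6,7)[of Y ?I]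
    unfolding S_def by (simp add: sum.distrib)
  also have "S X = (\<Sum>r\<in>?I. \<Sum>s\<in>?I. \<Sum>i\<in>?I. \<tau> [eb i, eb r, eb s] *
      (\<Sum>p\<in>?I. \<Sum>q\<in>?I. \<Sum>a\<in>?I. rho0 [eb i, eb p, eb q] * bracket_top p q r s a))"
    unfolding S_def sum_permute_4(8)[of X ?I, symmetric] X_def sum_distrib_left
    by (subst sum_permute_4(9)[symmetric]) (simp add: mult_ac)
  also have "\<dots> = 0" by (simp add: bracket_top_jacobi)
  also have "S Y = (\<Sum>s\<in>?I. \<Sum>i\<in>?I. \<Sum>p\<in>?I. \<tau> [eb i, eb p, eb s] *
      (\<Sum>q\<in>?I. \<Sum>r\<in>?I. \<Sum>a\<in>?I. rho0 [eb i, eb q, eb r] * bracket_top p q r s a))"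
    unfolding S_def sum_permute_4(9)[of Y ?I, symmetric] Y_def sum_distrib_left
    by (subst sum.swap[of _ ?I ?I], subst sum_permute_4(9)[symmetric]) (simp add: mult_ac)
  also have "\<dots> = 0"
  proof (rule sum.neutral, rule ballI)
    fix s
    define M where "M i p = (\<Sum>q\<in>?I. \<Sum>r\<in>?I. \<Sum>a\<in>?I. rho0 [eb i, eb q, eb r] * bracket_top p q r s a)" for i p
    \<comment> \<open>\<tau> is skew in \<open>i\<close> and \<open>p\<close>, whereas
      \<open>M\<close> is symmetric by \<open>bracket_top_symmetric\<close>; the double sum equals
      its own negative.\<close>
    have anti: "\<tau> [eb i, eb p, eb s] * M i p = - (\<tau> [eb p, eb i, eb s] * M p i)" for i p
      using Lam_swap[OF \<tau>, of "[]" "eb i" "[]" "eb p"] bracket_top_symmetric[of i p s]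
      by (simp add: M_def)
    have "(\<Sum>i\<in>?I. \<Sum>p\<in>?I. \<tau> [eb i, eb p, eb s] * M i p) =
        - (\<Sum>i\<in>?I. \<Sum>p\<in>?I. \<tau> [eb p, eb i, eb s] * M p i)"
      unfolding sum_negf[symmetric] by (intro sum.cong refl anti)
    also have "\<dots> = - (\<Sum>i\<in>?I. \<Sum>p\<in>?I. \<tau> [eb i, eb p, eb s] * M i p)"
      by (subst sum.swap) simp
    finally show "(\<Sum>i\<in>?I. \<Sum>p\<in>?I. \<tau> [eb i, eb p, eb s] *
      (\<Sum>q\<in>?I. \<Sum>r\<in>?I. \<Sum>a\<in>?I. rho0 [eb i, eb q, eb r] * bracket_top p q r s a)) = 0"
      unfolding M_def by linarith
  qed
  finally show ?thesis by simp
qed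

end

lemma sigma_plus_Lam:
  assumes "\<tau> \<in> Lam 3"
  shows "sigma_plus \<tau> \<in> Lam 4"
proof -
  have "(eb i \<lrcorner> rho0) \<and>\<^sub>\<Lambda> (eb i \<lrcorner> \<tau>) \<in> Lam (2 + 2)" for i
    by (intro Lam_wedge Lam_3_iprod rho0_Lam assms)
  then show ?thesis unfolding sigma_plus_def sigma_op_1 by (intro Lam_sum) simp
qed

text \<open>The derivation of \<open>vol\<close> by a skew map is zero, which trades brackets on
  \<open>u\<close>, \<open>v\<close>, \<open>w\<close> for brackets on the four indices contracted
  with \<open>sigma_plus \<tau>\<close>.\<close>

lemma hodge_sigma_plus_cyclic:
  assumes \<tau>: "\<tau> \<in> Lam 3"
  defines "F \<equiv> hodge (sigma_plus \<tau>)"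
  shows "(\<Sum>a\<in>{1..8}. F [eb a, bracket u (eb a), v, w] + F [eb a, bracket v (eb a), w, u]
    + F [eb a, bracket w (eb a), u, v]) = 0"
proof -
  let ?I = "{1..8::nat}"
  note V = vol_Lam
  define \<eta> where "\<eta> p q r s = sigma_plus \<tau> [eb p, eb q, eb r, eb s]" for p q r s
  define g where "g p q r s a = \<eta> p q r s * bracket_top vol u v w p q r s a" for p q r s a
  have \<eta>: "\<eta> q p r s = - \<eta> p q r s" "\<eta> r q p s = - \<eta> p q r s" "\<eta> s q r p = - \<eta> p q r s" for p q r s
    using Lam_swap[OF sigma_plus_Lam[OF \<tau>], of "[]" "eb q" "[]" "eb p"]
      Lam_swap[OF sigma_plus_Lam[OF \<tau>], of "[]" "eb r" "[eb q]" "eb p"]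
      Lam_swap[OF sigma_plus_Lam[OF \<tau>], of "[]" "eb s" "[eb q, eb r]" "eb p"]
    by (simp_all add: \<eta>_def)
  \<comment> \<open>The slot holding \<open>eb a\<close> itself drops out, since the bracket of
    \<open>eb a\<close> with itself is zero. The brackets on \<open>u\<close>, \<open>v\<close>,
    \<open>w\<close> form the left side, those on \<open>p\<close>, \<open>q\<close>,
    \<open>r\<close>, \<open>s\<close> the right side.\<close>
  have main: "vol [eb p, eb q, eb r, eb s, eb a, bracket u (eb a), v, w]
      + vol [eb p, eb q, eb r, eb s, eb a, bracket v (eb a), w, u]
      + vol [eb p, eb q, eb r, eb s, eb a, bracket w (eb a), u, v]
    = - bracket_top vol u v w p q r s a + bracket_top vol u v w q p r s a
      + bracket_top vol u v w r q p s a + bracket_top vol u v w s q r p a" for p q r s a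
  proof -
    let ?vs = "[eb p, eb q, eb r, eb s, eb a, u, v, w]" and ?b = "\<lambda>x. bracket x (eb a)"
    have "(\<Sum>l<length ?vs. vol (?vs[l := ?b (?vs ! l)])) = 0"
      by (rule skew_derivation_top_form[OF V linear_bracket bracket_skew])
    then have "vol [?b (eb p), eb q, eb r, eb s, eb a, u, v, w] + vol [eb p, ?b (eb q), eb r, eb s, eb a, u, v, w]
      + vol [eb p, eb q, ?b (eb r), eb s, eb a, u, v, w] + vol [eb p, eb q, eb r, ?b (eb s), eb a, u, v, w]
      + vol [eb p, eb q, eb r, eb s, 0, u, v, w] + vol [eb p, eb q, eb r, eb s, eb a, ?b u, v, w]
      + vol [eb p, eb q, eb r, eb s, eb a, u, ?b v, w] + vol [eb p, eb q, eb r, eb s, eb a, u, v, ?b w] = 0"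
      by (simp add: bracket_self)
    moreover have "vol [eb p, eb q, eb r, eb s, 0, u, v, w] = 0"
      using linear_0[OF Lam_linear[OF V, of "[eb p, eb q, eb r, eb s]" "[u, v, w]"]] by simp
    moreover have "vol [eb p, ?b (eb q), eb r, eb s, eb a, u, v, w] = - vol [?b (eb q), eb p, eb r, eb s, eb a, u, v, w]"
      using Lam_swap[OF V, of "[]" "eb p" "[]" "?b (eb q)"] by simp
    moreover have "vol [eb p, eb q, ?b (eb r), eb s, eb a, u, v, w] = - vol [?b (eb r), eb q, eb p, eb s, eb a, u, v, w]"
      using Lam_swap[OF V, of "[]" "eb p" "[eb q]" "?b (eb r)"] by simp
    moreover have "vol [eb p, eb q, eb r, ?b (eb s), eb a, u, v, w] = - vol [?b (eb s), eb q, eb r, eb p, eb a, u, v, w]"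
      using Lam_swap[OF V, of "[]" "eb p" "[eb q, eb r]" "?b (eb s)"] by simp
    moreover have "vol [eb p, eb q, eb r, eb s, eb a, ?b v, w, u] = vol [eb p, eb q, eb r, eb s, eb a, u, ?b v, w]"
      using Lam_swap[OF V, of "[eb p, eb q, eb r, eb s, eb a]" "?b v" "[]" u "[w]"]
        Lam_swap[OF V, of "[eb p, eb q, eb r, eb s, eb a, ?b v]" w "[]" u "[]"] by simp
    moreover have "vol [eb p, eb q, eb r, eb s, eb a, ?b w, u, v] = vol [eb p, eb q, eb r, eb s, eb a, u, v, ?b w]"
      using Lam_swap[OF V, of "[eb p, eb q, eb r, eb s, eb a]" "?b w" "[]" u "[v]"]
        Lam_swap[OF V, of "[eb p, eb q, eb r, eb s, eb a, u]" "?b w" "[]" v "[]"] by simp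
    ultimately show ?thesis unfolding bracket_top_def[OF V] by linarith
  qed
  have F: "24 * F xs = (\<Sum>p\<in>?I. \<Sum>q\<in>?I. \<Sum>r\<in>?I. \<Sum>s\<in>?I. \<eta> p q r s * vol (eb p # eb q # eb r # eb s # xs))"
    for xs
    unfolding F_def \<eta>_def by (rule hodge_4[OF sigma_plus_Lam[OF \<tau>]])
  \<comment> \<open>Bringing the bracketed slot to the front is a transposition that \<eta>
    undergoes as well, so all four terms acquire the same sign.\<close>
  have pointwise: "\<eta> p q r s * (- bracket_top vol u v w p q r s a + bracket_top vol u v w q p r s a
      + bracket_top vol u v w r q p s a + bracket_top vol u v w s q r p a) =
    - g p q r s a - g q p r s a - g r q p s a - g s q r p a" for p q r s a
    unfolding g_def \<eta>[where p = p and q = q and r = r and s = s]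
    by (simp add: distrib_left right_diff_distrib)
  define h where "h p q r s = (\<Sum>a\<in>?I. g p q r s a)" for p q r s
  have "24 * (\<Sum>a\<in>?I. F [eb a, bracket u (eb a), v, w] + F [eb a, bracket v (eb a), w, u]
      + F [eb a, bracket w (eb a), u, v]) =
    (\<Sum>a\<in>?I. 24 * F [eb a, bracket u (eb a), v, w] + 24 * F [eb a, bracket v (eb a), w, u]
      + 24 * F [eb a, bracket w (eb a), u, v])"
    by (simp add: sum_distrib_left)
  also have "\<dots> = (\<Sum>a\<in>?I. \<Sum>p\<in>?I. \<Sum>q\<in>?I. \<Sum>r\<in>?I. \<Sum>s\<in>?I.
      - g p q r s a - g q p r s a - g r q p s a - g s q r p a)"
    unfolding F sum.distrib[symmetric] distrib_left[symmetric] main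
    by (intro sum.cong refl pointwise)
  also have "\<dots> = (\<Sum>p\<in>?I. \<Sum>q\<in>?I. \<Sum>r\<in>?I. \<Sum>s\<in>?I. - h p q r s - h q p r s - h r q p s - h s q r p)"
    unfolding h_def
    by (subst sum.swap, rule sum.cong, rule refl, subst sum.swap, rule sum.cong, rule refl,
        subst sum.swap, rule sum.cong, rule refl, subst sum.swap, rule sum.cong, rule refl)
      (simp add: sum.distrib sum_subtractf sum_negf)
  also have "\<dots> = - 4 * (\<Sum>p\<in>?I. \<Sum>q\<in>?I. \<Sum>r\<in>?I. \<Sum>s\<in>?I. h p q r s)"
    using sum_permute_4(1,2,3)[of h ?I] by (simp add: sum.distrib sum_subtractf sum_negf)
  also have "\<dots> = 0"
    using sum_alternating_bracket_top[OF V \<tau>, of u v w] by (simp add: h_def g_def \<eta>_def)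
  finally show ?thesis by simp
qed

section \<open>Derivations of forms induced by a connection\<close>

lemma wedge_sum_left: "(\<Sum>i\<in>A. \<alpha> i) \<and>\<^sub>\<Lambda> \<beta> = (\<Sum>i\<in>A. \<alpha> i \<and>\<^sub>\<Lambda> \<beta>)"
  by (induction A rule: infinite_finite_induct)
    (simp_all only: simp_thms sum.infinite sum.empty sum.insert wedge_zero_left wedge_add_left)

lemma wedge_sum_right: "\<alpha> \<and>\<^sub>\<Lambda> (\<Sum>i\<in>A. \<beta> i) = (\<Sum>i\<in>A. \<alpha> \<and>\<^sub>\<Lambda> \<beta> i)"
  by (induction A rule: infinite_finite_induct)
    (simp_all only: simp_thms sum.infinite sum.empty sum.insert wedge_zero_right wedge_add_right)

lemma wedge_diff_left: "(\<alpha> - \<alpha>') \<and>\<^sub>\<Lambda> \<beta> = \<alpha> \<and>\<^sub>\<Lambda> \<beta> - \<alpha>' \<and>\<^sub>\<Lambda> \<beta>"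
  by (rule ext) (simp add: wedge_def left_diff_distrib right_diff_distrib sum_subtractf)

lemma wedge_uminus_right: "\<alpha> \<and>\<^sub>\<Lambda> - \<beta> = - (\<alpha> \<and>\<^sub>\<Lambda> \<beta>)"
  by (rule ext) (simp add: wedge_def sum_negf)

lemma Lam_2_eqI:
  assumes "\<omega> \<in> Lam 2" "\<omega>' \<in> Lam 2" "\<And>u v. \<omega> [u, v] = \<omega>' [u, v]"
  shows "\<omega> = \<omega>'"
proof
  fix vs
  show "\<omega> vs = \<omega>' vs"
  proof (cases "length vs = 2")
    case True
    then obtain u v where "vs = [u, v]" by (auto simp: numeral_2_eq_2 length_Suc_conv)
    then show ?thesis using assms(3) by simp
  next
    case False
    then show ?thesis using assms(1,2)[THEN Lam_length] by simp
  qed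
qed

lemma wedge_1_self:
  assumes "\<theta> \<in> Lam 1"
  shows "\<theta> \<and>\<^sub>\<Lambda> \<theta> = 0"
proof -
  have "\<theta> \<and>\<^sub>\<Lambda> \<theta> \<in> Lam (1 + 1)" by (intro Lam_wedge assms)
  then have "\<theta> \<and>\<^sub>\<Lambda> \<theta> \<in> Lam 2" by simp
  moreover have "(\<theta> \<and>\<^sub>\<Lambda> \<theta>) [u, v] = 0" for u v
    by (simp add: wedge_1_Cons[OF assms] wedge_1_Nil[OF assms])
  ultimately show ?thesis by (intro Lam_2_eqI) auto
qed

lemma flat_wedge_expand:
  "(flat X \<and>\<^sub>\<Lambda> \<beta>) vs = (\<Sum>i<length vs. (- 1) ^ i * (X \<bullet> vs ! i) * \<beta> (take i vs @ drop (Suc i) vs))"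
proof (induction vs arbitrary: \<beta>)
  case (Cons v vs)
  show ?case
    unfolding flat_wedge_Cons Cons.IH
    by (simp add: lessThan_Suc_eq_insert_0 sum.reindex sum_negf)
qed simp

text \<open>Wedging with the dual basis is alternation over the differentiation slot; the right side
  has the shape of \<open>ext_d\<close>.\<close>

lemma sum_flat_wedge:
  assumes "\<And>ws. linear (\<lambda>u. \<beta> u ws)"
  shows "(\<Sum>j\<in>{1..8}. (flat (eb j) \<and>\<^sub>\<Lambda> \<beta> (eb j)) vs) =
    (\<Sum>i<length vs. (- 1) ^ i * \<beta> (vs ! i) (take i vs @ drop (Suc i) vs))"
proof -
  have expand: "(\<Sum>j\<in>{1..8}. (vs ! i \<bullet> eb j) * \<beta> (eb j) ws) = \<beta> (vs ! i) ws" for i ws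
    using linear_eb_expansion[OF assms[of ws], of "vs ! i"] by simp
  have "(\<Sum>j\<in>{1..8}. (flat (eb j) \<and>\<^sub>\<Lambda> \<beta> (eb j)) vs) = (\<Sum>i<length vs. (- 1) ^ i *
      (\<Sum>j\<in>{1..8}. (vs ! i \<bullet> eb j) * \<beta> (eb j) (take i vs @ drop (Suc i) vs)))"
    unfolding flat_wedge_expand
    by (subst sum.swap) (simp add: sum_distrib_left inner_commute mult.assoc)
  then show ?thesis unfolding expand .
qed

text \<open>Write \<open>D u\<close> as a sum of wedge products by
  \<open>derivation_eq_wedge\<close> and alternate over \<open>u\<close>. Associativity then
  gathers, for each \<open>k\<close>, one 2-form in front of
  \<open>eb k \<lrcorner> \<alpha>\<close>, and it sees only the skew part of \<open>b\<close>: a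
  torsion component.\<close>

lemma alternated_derivation:
  assumes \<alpha>: "\<alpha> \<in> Lam n"
    and b2: "\<And>u. linear (b u)" and b1: "\<And>v. linear (\<lambda>u. b u v)"
    and \<omega>: "\<And>k. \<omega> k \<in> Lam 2" "\<And>k u v. \<omega> k [u, v] = (b u v - b v u) \<bullet> eb k"
    and D: "\<And>u ws. D u ws = (\<Sum>l<length ws. \<alpha> (ws[l := b u (ws ! l)]))"
  shows "(\<Sum>i<length vs. (- 1) ^ i * D (vs ! i) (take i vs @ drop (Suc i) vs)) =
    (\<Sum>k\<in>{1..8}. (\<omega> k \<and>\<^sub>\<Lambda> (eb k \<lrcorner> \<alpha>)) vs)"
proof -
  let ?\<theta> = "\<lambda>j k. flat (adjoint (b (eb j)) (eb k))"
  have lin: "linear (\<lambda>u. D u ws)" for ws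
  proof -
    have "linear (\<lambda>u. \<alpha> (ws[l := b u (ws ! l)]))" if "l < length ws" for l
      using linear_compose[OF b1 Lam_linear_update[OF \<alpha> that]] by (simp add: o_def)
    then show ?thesis unfolding D by (intro linear_compose_sum) auto
  qed
  have D': "D u = (\<Sum>k\<in>{1..8}. flat (adjoint (b u) (eb k)) \<and>\<^sub>\<Lambda> (eb k \<lrcorner> \<alpha>))" for u
    unfolding fun_eq_iff form_sum_apply D derivation_eq_wedge[OF \<alpha> b2] by simp
  have \<omega>': "(\<Sum>j\<in>{1..8}. flat (eb j) \<and>\<^sub>\<Lambda> ?\<theta> j k) = \<omega> k" for k
  proof (rule Lam_2_eqI[OF _ \<omega>(1)])
    have "flat (eb j) \<and>\<^sub>\<Lambda> ?\<theta> j k \<in> Lam (1 + 1)" for j by (intro Lam_wedge flat_Lam)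
    then show "(\<Sum>j\<in>{1..8}. flat (eb j) \<and>\<^sub>\<Lambda> ?\<theta> j k) \<in> Lam 2" by (intro Lam_sum) simp
    fix u v
    have "linear (\<lambda>x. b x y \<bullet> eb k)" for y
      by (rule linearI) (simp_all add: linear_add[OF b1] linear_scale[OF b1] inner_add_left)
    note expand = linear_eb_expansion[OF this]
    have "(flat (eb j) \<and>\<^sub>\<Lambda> ?\<theta> j k) [u, v] = (u \<bullet> eb j) * (b (eb j) v \<bullet> eb k) - (v \<bullet> eb j) * (b (eb j) u \<bullet> eb k)"
      for j by (simp add: flat_wedge_Cons flat_adjoint[OF b2] inner_commute[of "eb j"] del: flat_simps(2))
    then show "(\<Sum>j\<in>{1..8}. flat (eb j) \<and>\<^sub>\<Lambda> ?\<theta> j k) [u, v] = \<omega> k [u, v]"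
      by (simp add: form_sum_apply \<omega>(2) inner_diff_left expand[of v u] expand[of u v] sum_subtractf)
  qed
  have "(\<Sum>i<length vs. (- 1) ^ i * D (vs ! i) (take i vs @ drop (Suc i) vs)) =
      (\<Sum>j\<in>{1..8}. (flat (eb j) \<and>\<^sub>\<Lambda> D (eb j)) vs)"
    by (rule sum_flat_wedge[OF lin, symmetric])
  also have "\<dots> = (\<Sum>j\<in>{1..8}. \<Sum>k\<in>{1..8}. (flat (eb j) \<and>\<^sub>\<Lambda> (?\<theta> j k \<and>\<^sub>\<Lambda> (eb k \<lrcorner> \<alpha>))) vs)"
    unfolding D' wedge_sum_right form_sum_apply ..
  also have "\<dots> = (\<Sum>k\<in>{1..8}. ((\<Sum>j\<in>{1..8}. flat (eb j) \<and>\<^sub>\<Lambda> ?\<theta> j k) \<and>\<^sub>\<Lambda> (eb k \<lrcorner> \<alpha>)) vs)"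
    by (subst sum.swap) (simp add: wedge_sum_left form_sum_apply wedge_assoc[OF flat_Lam flat_Lam])
  finally show ?thesis unfolding \<omega>' .
qed

section \<open>The contraction of \<open>u \<lrcorner> rho0\<close> into \<open>F\<close>\<close>

lemma contr_rho0_Lam: "F \<in> Lam 4 \<Longrightarrow> contr 2 (u \<lrcorner> rho0) F \<in> Lam 2"
  by (rule contr_Lam[OF Lam_3_iprod[OF rho0_Lam]]) simp

lemma contr_rho0_eq:
  assumes "F \<in> Lam 4"
  shows "2 * contr 2 (u \<lrcorner> rho0) F [v, w] = (\<Sum>a\<in>{1..8}. F [eb a, bracket u (eb a), v, w])"
proof -
  have lin: "linear (\<lambda>z. F [eb a, z, v, w])" for a
    using Lam_linear[OF assms, of "[eb a]" "[v, w]"] by simp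
  show ?thesis
    by (simp add: contr_2[OF Lam_3_iprod[OF rho0_Lam] assms] bracket_def linear_sum[OF lin]
        linear_scale[OF lin])
qed

lemma hodge_sigma_plus_Lam: "\<tau> \<in> Lam 3 \<Longrightarrow> hodge (sigma_plus \<tau>) \<in> Lam 4"
  by (rule hodge_Lam[OF sigma_plus_Lam]) simp_all

lemma Lam3_8_subset: "Lam3_8 \<subseteq> Lam 3"
proof
  fix T assume "T \<in> Lam3_8"
  then obtain \<theta> where \<theta>: "\<theta> \<in> Lam 1" and T: "T = hodge (sigma_plus \<theta> \<and>\<^sub>\<Lambda> rho0)"
    by (auto simp: Lam3_8_def Lam2_8_def)
  have "(eb i \<lrcorner> rho0) \<and>\<^sub>\<Lambda> (eb i \<lrcorner> \<theta>) \<in> Lam (2 + 0)" for i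
    using \<theta> by (intro Lam_wedge Lam_3_iprod rho0_Lam Lam_iprod) (simp add: One_nat_def)
  then have "sigma_plus \<theta> \<in> Lam 2"
    unfolding sigma_plus_def sigma_op_1 by (intro Lam_sum) simp
  then have "sigma_plus \<theta> \<and>\<^sub>\<Lambda> rho0 \<in> Lam (2 + 3)" by (intro Lam_wedge rho0_Lam)
  then show "T \<in> Lam 3" unfolding T by (intro hodge_Lam) simp_all
qed

lemma hodge_Lam4_eq:
  assumes "F \<in> hodge ` Lam4_8 + hodge ` Lam4_27"
  obtains \<tau> \<tau>' where "\<tau> \<in> Lam 3" "\<tau>' \<in> Lam 3" "F = hodge (sigma_plus \<tau>) + hodge (sigma_plus \<tau>')"
  using assms Lam3_8_subset
  by (fastforce simp: set_plus_def Lam4_8_def Lam4_27_def Lam3_27_def)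

lemma hodge_Lam4_Lam: "F \<in> hodge ` Lam4_8 + hodge ` Lam4_27 \<Longrightarrow> F \<in> Lam 4"
  by (elim hodge_Lam4_eq) (auto intro: hodge_sigma_plus_Lam)

text \<open>Each contraction is already skew in its two arguments, so the cyclic identity says that
  their total alternation vanishes. It is linear in \<open>F\<close>, hence both summands of
  \<open>F\<close> can be treated separately.\<close>

lemma contr_rho0_cyclic:
  assumes F: "F \<in> hodge ` Lam4_8 + hodge ` Lam4_27"
  shows "contr 2 (u \<lrcorner> rho0) F [v, w] + contr 2 (v \<lrcorner> rho0) F [w, u] + contr 2 (w \<lrcorner> rho0) F [u, v] = 0"
proof -
  obtain \<tau> \<tau>' where "\<tau> \<in> Lam 3" "\<tau>' \<in> Lam 3" "F = hodge (sigma_plus \<tau>) + hodge (sigma_plus \<tau>')"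
    using F by (rule hodge_Lam4_eq)
  then have "(\<Sum>a\<in>{1..8}. F [eb a, bracket u (eb a), v, w] + F [eb a, bracket v (eb a), w, u]
      + F [eb a, bracket w (eb a), u, v]) = 0"
    using hodge_sigma_plus_cyclic[of \<tau> u v w] hodge_sigma_plus_cyclic[of \<tau>' u v w]
    by (simp add: sum.distrib)
  then show ?thesis
    unfolding sum.distrib contr_rho0_eq[OF hodge_Lam4_Lam[OF F], symmetric] by linarith
qed

lemma wedge_uminus_left: "(- \<alpha>) \<and>\<^sub>\<Lambda> \<beta> = - (\<alpha> \<and>\<^sub>\<Lambda> \<beta>)"
  by (rule ext) (simp add: wedge_def sum_negf)

text \<open>Origin of the coefficient 3: moving \<open>eb i\<close> to the front of \<open>F\<close>
  is an odd permutation, and the sum over ordered indices is 2 times the left side and 6 times the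
  triple contraction.\<close>

lemma contr_rho0_trace:
  assumes F: "F \<in> Lam 4"
  shows "(\<Sum>i\<in>{1..8}. contr 2 (eb i \<lrcorner> rho0) F [v, eb i]) = - 3 * contr 3 rho0 F [v]"
proof -
  let ?I = "{1..8::nat}"
  have "F [eb a, eb b, v, eb i] = - F [eb i, eb a, eb b, v]" for a b i
    using Lam_swap[OF F, of "[]" "eb a" "[eb b, v]" "eb i" "[]"]
      Lam_swap[OF F, of "[eb i]" "eb b" "[v]" "eb a" "[]"]
      Lam_swap[OF F, of "[eb i, eb a]" v "[]" "eb b" "[]"] by simp
  then have "2 * (\<Sum>i\<in>?I. contr 2 (eb i \<lrcorner> rho0) F [v, eb i]) =
      (\<Sum>i\<in>?I. \<Sum>a\<in>?I. \<Sum>b\<in>?I. - (rho0 [eb i, eb a, eb b] * F [eb i, eb a, eb b, v]))"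
    unfolding sum_distrib_left contr_2[OF Lam_3_iprod[OF rho0_Lam] F] by simp
  also have "\<dots> = - (6 * contr 3 rho0 F [v])"
    unfolding contr_3[OF rho0_Lam F] by (simp add: sum_negf)
  finally show ?thesis by simp
qed

lemma linear_rho0_contr: "F \<in> Lam 4 \<Longrightarrow> linear (\<lambda>u. contr 2 (u \<lrcorner> rho0) F [v, w])"
proof (rule linearI)
  fix x y :: vec8 and r :: real
  assume F: "F \<in> Lam 4"
  have lin: "linear (\<lambda>u. rho0 [u, v, w])" for v w
    using Lam_linear[OF rho0_Lam, of "[]" "[v, w]"] by simp
  have c: "contr 2 (u \<lrcorner> rho0) F [v, w] =
      (\<Sum>a\<in>{1..8}. \<Sum>b\<in>{1..8}. rho0 [u, eb a, eb b] * F [eb a, eb b, v, w]) / 2" for u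
    using contr_2[OF Lam_3_iprod[OF rho0_Lam] F, of u "[v, w]"] by simp
  show "contr 2 ((x + y) \<lrcorner> rho0) F [v, w] = contr 2 (x \<lrcorner> rho0) F [v, w] + contr 2 (y \<lrcorner> rho0) F [v, w]"
    unfolding c by (simp add: linear_add[OF lin] distrib_right sum.distrib add_divide_distrib)
  show "contr 2 ((r *\<^sub>R x) \<lrcorner> rho0) F [v, w] = r *\<^sub>R contr 2 (x \<lrcorner> rho0) F [v, w]"
    unfolding c by (simp add: linear_scale[OF lin] sum_distrib_left mult.assoc)
qed

text \<open>The difference of the characteristic and the Levi-Civita connection in an adapted frame, as a
  2-form and as the corresponding skew map.\<close>

definition char_form :: "form \<Rightarrow> form \<Rightarrow> vec8 \<Rightarrow> form" where
  "char_form T F u = (1 / 2) \<cdot> (u \<lrcorner> T) + contr 2 (u \<lrcorner> rho0) F"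

definition char_map :: "form \<Rightarrow> form \<Rightarrow> vec8 \<Rightarrow> vec8 \<Rightarrow> vec8" where
  "char_map T F u v = (\<Sum>k\<in>{1..8}. char_form T F u [v, eb k] *\<^sub>R eb k)"

context
  fixes T F :: form
  assumes T: "T \<in> Lam 3" and F: "F \<in> Lam 4"
begin

lemma char_form_Lam: "char_form T F u \<in> Lam 2"
  unfolding char_form_def by (intro Lam_add Lam_scale Lam_3_iprod T contr_rho0_Lam F)

lemma char_form_apply: "char_form T F u [v, w] = T [u, v, w] / 2 + contr 2 (u \<lrcorner> rho0) F [v, w]"
  by (simp add: char_form_def)

lemma inner_char_map: "char_map T F u v \<bullet> w = char_form T F u [v, w]"
proof -
  have "linear (\<lambda>w. char_form T F u [v, w])"
    using Lam_linear[OF char_form_Lam, of u "[v]" "[]"] by simp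
  from linear_eb_expansion[OF this, of w] show ?thesis
    by (simp add: char_map_def inner_sum_left inner_commute[of w] mult.commute)
qed

lemma linear_char_map_right: "linear (char_map T F u)"
proof -
  have lin: "linear (\<lambda>v. char_form T F u [v, w])" for w
    using Lam_linear[OF char_form_Lam, of u "[]" "[w]"] by simp
  show ?thesis
    by (rule linearI)
      (simp_all add: char_map_def linear_add[OF lin] linear_scale[OF lin] scaleR_left_distrib
        sum.distrib scaleR_sum_right)
qed

lemma linear_char_map_left: "linear (\<lambda>u. char_map T F u v)"
proof -
  have lin: "linear (\<lambda>u. T [u, v, w])" for v w using Lam_linear[OF T, of "[]" "[v, w]"] by simp
  have "char_form T F (x + y) [v, w] = char_form T F x [v, w] + char_form T F y [v, w]"
    "char_form T F (r *\<^sub>R x) [v, w] = r * char_form T F x [v, w]" for x y w r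
    unfolding char_form_apply linear_add[OF lin] linear_scale[OF lin]
      linear_add[OF linear_rho0_contr[OF F]] linear_scale[OF linear_rho0_contr[OF F]]
    by (simp_all add: field_simps)
  then show ?thesis
    by (intro linearI)
      (simp_all add: char_map_def scaleR_left_distrib sum.distrib scaleR_sum_right)
qed

text \<open>In the skew part of \<gamma> plus \<open>char_map\<close> the symmetric \<gamma>
  disappears, the two halves of \<open>T\<close> add up to \<open>T\<close>, and the cyclic identity
  merges the two contraction terms into a single one with a minus sign.\<close>

lemma alternated_char_derivation:
  assumes cyclic: "\<And>u v w. contr 2 (u \<lrcorner> rho0) F [v, w] + contr 2 (v \<lrcorner> rho0) F [w, u]
      + contr 2 (w \<lrcorner> rho0) F [u, v] = 0"
    and \<gamma>: "\<And>u. linear (\<gamma> u)" "\<And>v. linear (\<lambda>u. \<gamma> u v)" "\<And>u v. \<gamma> u v = \<gamma> v u"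
    and \<alpha>: "\<alpha> \<in> Lam n"
    and D: "\<And>u ws. D u ws = (\<Sum>l<length ws. \<alpha> (ws[l := \<gamma> u (ws ! l) + char_map T F u (ws ! l)]))"
  shows "(\<lambda>vs. \<Sum>i<length vs. (- 1) ^ i * D (vs ! i) (take i vs @ drop (Suc i) vs)) =
    (\<Sum>k\<in>{1..8}. (eb k \<lrcorner> T) \<and>\<^sub>\<Lambda> (eb k \<lrcorner> \<alpha>)) - (\<Sum>k\<in>{1..8}. contr 2 (eb k \<lrcorner> rho0) F \<and>\<^sub>\<Lambda> (eb k \<lrcorner> \<alpha>))"
    (is "?L = ?R")
proof
  fix vs
  define \<omega> where "\<omega> k = (eb k \<lrcorner> T) - contr 2 (eb k \<lrcorner> rho0) F" for k
  have "?L vs = (\<Sum>k\<in>{1..8}. (\<omega> k \<and>\<^sub>\<Lambda> (eb k \<lrcorner> \<alpha>)) vs)"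
  proof (rule alternated_derivation[OF \<alpha>, where b = "\<lambda>u v. \<gamma> u v + char_map T F u v"])
    show "linear (\<lambda>v. \<gamma> u v + char_map T F u v)" for u
      by (intro linear_compose_add \<gamma> linear_char_map_right)
    show "linear (\<lambda>u. \<gamma> u v + char_map T F u v)" for v
      by (intro linear_compose_add \<gamma> linear_char_map_left)
    show "\<omega> k \<in> Lam 2" for k
      unfolding \<omega>_def by (intro Lam_diff Lam_3_iprod T contr_rho0_Lam F)
    show "\<omega> k [u, v] = (\<gamma> u v + char_map T F u v - (\<gamma> v u + char_map T F v u)) \<bullet> eb k" for k u v
    proof -
      have "T [u, v, eb k] = T [eb k, u, v]" "T [v, u, eb k] = - T [eb k, u, v]"
        using Lam_swap[OF T, of "[u]" v "[]" "eb k"] Lam_swap[OF T, of "[]" u "[]" "eb k" "[v]"]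
          Lam_swap[OF T, of "[]" v "[u]" "eb k" "[]"] by simp_all
      moreover have "contr 2 (v \<lrcorner> rho0) F [u, eb k] = - contr 2 (v \<lrcorner> rho0) F [eb k, u]"
        using Lam_swap[OF contr_rho0_Lam[OF F, of v], of "[]" u "[]" "eb k" "[]"] by simp
      ultimately show ?thesis
        using cyclic[of u v "eb k"] \<gamma>(3)[of u v]
        by (simp add: \<omega>_def inner_diff_left inner_char_map char_form_apply)
    qed
  qed (rule D)
  also have "\<dots> = ?R vs"
    by (simp add: \<omega>_def wedge_diff_left form_sum_apply sum_subtractf)
  finally show "?L vs = ?R vs" .
qed

text \<open>Inserting \<open>eb i\<close> into a wedge of a 1-form with
  \<open>eb k \<lrcorner> \<alpha>\<close> either feeds the 1-form, which gives a trace, or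
  contracts \<alpha> once more, which gives the double sums.\<close>

lemma contracted_char_derivation:
  assumes \<alpha>: "\<alpha> \<in> Lam n"
  shows "(\<lambda>vs. - (\<Sum>i\<in>{1..8}. \<Sum>l<length (eb i # vs).
      \<alpha> ((eb i # vs)[l := char_map T F (eb i) ((eb i # vs) ! l)]))) =
    - (3 \<cdot> contr 1 (contr 3 rho0 F) \<alpha>)
      + (1 / 2) \<cdot> (\<Sum>i\<in>{1..8}. \<Sum>j\<in>{1..8}. (eb i \<lrcorner> eb j \<lrcorner> T) \<and>\<^sub>\<Lambda> (eb i \<lrcorner> eb j \<lrcorner> \<alpha>))
      + (\<Sum>i\<in>{1..8}. \<Sum>j\<in>{1..8}. (eb i \<lrcorner> contr 2 (eb j \<lrcorner> rho0) F) \<and>\<^sub>\<Lambda> (eb i \<lrcorner> eb j \<lrcorner> \<alpha>))"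
    (is "?L = ?R")
proof
  fix vs
  let ?I = "{1..8::nat}"
  let ?B = "char_form T F" and ?S = "\<lambda>u. contr 2 (u \<lrcorner> rho0) F"
  have swap: "u \<lrcorner> v \<lrcorner> \<beta> = - (v \<lrcorner> u \<lrcorner> \<beta>)" if "\<beta> \<in> Lam m" for u v m and \<beta> :: form
    using Lam_swap[OF that, of "[]" v "[]" u] by (simp add: fun_eq_iff)
  have adj: "flat (adjoint (char_map T F u) (eb k)) = - (eb k \<lrcorner> ?B u)" for u k
  proof
    fix ws
    show "flat (adjoint (char_map T F u) (eb k)) ws = (- (eb k \<lrcorner> ?B u)) ws"
    proof (cases "length ws = 1")
      case True
      then obtain v where "ws = [v]" by (auto simp: One_nat_def length_Suc_conv)
      then show ?thesis
        using Lam_swap[OF char_form_Lam, of u "[]" v "[]" "eb k" "[]"]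
        by (simp add: flat_adjoint[OF linear_char_map_right] inner_char_map del: flat_simps(2))
    next
      case False
      then show ?thesis
        using Lam_length[OF flat_Lam] Lam_length[OF char_form_Lam, of "eb k # ws"] by simp
    qed
  qed
  have "?L vs = - (\<Sum>i\<in>?I. \<Sum>k\<in>?I. ((- (eb k \<lrcorner> ?B (eb i))) \<and>\<^sub>\<Lambda> (eb k \<lrcorner> \<alpha>)) (eb i # vs))"
    unfolding derivation_eq_wedge[OF \<alpha> linear_char_map_right] adj ..
  also have "\<dots> = (\<Sum>i\<in>?I. \<Sum>k\<in>?I. ?B (eb i) [eb k, eb i] * \<alpha> (eb k # vs)
      - ((eb k \<lrcorner> ?B (eb i)) \<and>\<^sub>\<Lambda> (eb i \<lrcorner> eb k \<lrcorner> \<alpha>)) vs)"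
  proof -
    have pointwise: "((- (eb k \<lrcorner> ?B (eb i))) \<and>\<^sub>\<Lambda> (eb k \<lrcorner> \<alpha>)) (eb i # vs) =
        - (?B (eb i) [eb k, eb i] * \<alpha> (eb k # vs) - ((eb k \<lrcorner> ?B (eb i)) \<and>\<^sub>\<Lambda> (eb i \<lrcorner> eb k \<lrcorner> \<alpha>)) vs)" for i k
      using wedge_1_Cons[OF Lam_uminus[OF Lam_2_iprod(1)[OF char_form_Lam]],
          of "eb k" "eb i" "eb k \<lrcorner> \<alpha>" "eb i" vs]
      by (simp add: wedge_uminus_left)
    show ?thesis unfolding pointwise sum_negf by simp
  qed
  also have "\<dots> = (\<Sum>k\<in>?I. (\<Sum>i\<in>?I. ?B (eb i) [eb k, eb i]) * \<alpha> (eb k # vs))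
      - (\<Sum>i\<in>?I. \<Sum>k\<in>?I. ((eb k \<lrcorner> ?B (eb i)) \<and>\<^sub>\<Lambda> (eb i \<lrcorner> eb k \<lrcorner> \<alpha>)) vs)"
    using sum.swap[of "\<lambda>i k. ?B (eb i) [eb k, eb i] * \<alpha> (eb k # vs)" ?I ?I]
    by (simp only: sum_distrib_right sum_subtractf)
  \<comment> \<open>\<open>T\<close> has no trace, as \<open>eb i\<close> would occur in it twice;
    only \<open>F\<close> contributes.\<close>
  also have "(\<Sum>k\<in>?I. (\<Sum>i\<in>?I. ?B (eb i) [eb k, eb i]) * \<alpha> (eb k # vs)) =
      (- (3 \<cdot> contr 1 (contr 3 rho0 F) \<alpha>)) vs"
  proof -
    have "(\<Sum>i\<in>?I. ?B (eb i) [eb k, eb i]) = - 3 * contr 3 rho0 F [eb k]" for k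
      using Lam_alternating[OF T, of "[]" _ "[eb k]" "[]"] contr_rho0_trace[OF F, of "eb k"]
      by (simp add: char_form_apply)
    moreover have "contr 3 rho0 F \<in> Lam 1" by (rule contr_Lam[OF rho0_Lam]) (use F in simp)
    ultimately show ?thesis
      by (simp add: contr_1[OF _ \<alpha>] sum_distrib_left sum_negf mult.assoc)
  qed
  also have "(\<Sum>i\<in>?I. \<Sum>k\<in>?I. ((eb k \<lrcorner> ?B (eb i)) \<and>\<^sub>\<Lambda> (eb i \<lrcorner> eb k \<lrcorner> \<alpha>)) vs) =
      - ((1 / 2) \<cdot> (\<Sum>i\<in>?I. \<Sum>k\<in>?I. (eb i \<lrcorner> eb k \<lrcorner> T) \<and>\<^sub>\<Lambda> (eb i \<lrcorner> eb k \<lrcorner> \<alpha>))) vs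
      - (\<Sum>k\<in>?I. \<Sum>i\<in>?I. (eb k \<lrcorner> ?S (eb i)) \<and>\<^sub>\<Lambda> (eb k \<lrcorner> eb i \<lrcorner> \<alpha>)) vs"
  proof -
    \<comment> \<open>One exchange of contractions produces the minus sign on the \<open>T\<close>
      part. In the \<open>F\<close> part the order is left as it is and \<alpha> is swapped instead,
      to match the final index pattern.\<close>
    have "eb k \<lrcorner> ?B (eb i) = (- 1 / 2) \<cdot> (eb i \<lrcorner> eb k \<lrcorner> T) + (eb k \<lrcorner> ?S (eb i))" for i k
      using Lam_swap[OF T, of "[]" "eb i" "[]" "eb k"] by (simp add: fun_eq_iff char_form_def)
    then have "((eb k \<lrcorner> ?B (eb i)) \<and>\<^sub>\<Lambda> (eb i \<lrcorner> eb k \<lrcorner> \<alpha>)) vs =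
        - (1 / 2 * ((eb i \<lrcorner> eb k \<lrcorner> T) \<and>\<^sub>\<Lambda> (eb i \<lrcorner> eb k \<lrcorner> \<alpha>)) vs)
        - ((eb k \<lrcorner> ?S (eb i)) \<and>\<^sub>\<Lambda> (eb k \<lrcorner> eb i \<lrcorner> \<alpha>)) vs" for i k
      unfolding swap[OF \<alpha>, of "eb k" "eb i"]
      by (simp add: wedge_add_left wedge_scale_left wedge_uminus_right del: iprod_apply)
    then have "(\<Sum>i\<in>?I. \<Sum>k\<in>?I. ((eb k \<lrcorner> ?B (eb i)) \<and>\<^sub>\<Lambda> (eb i \<lrcorner> eb k \<lrcorner> \<alpha>)) vs) =
        - (1 / 2 * (\<Sum>i\<in>?I. \<Sum>k\<in>?I. ((eb i \<lrcorner> eb k \<lrcorner> T) \<and>\<^sub>\<Lambda> (eb i \<lrcorner> eb k \<lrcorner> \<alpha>)) vs))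
        - (\<Sum>i\<in>?I. \<Sum>k\<in>?I. ((eb k \<lrcorner> ?S (eb i)) \<and>\<^sub>\<Lambda> (eb k \<lrcorner> eb i \<lrcorner> \<alpha>)) vs)"
      by (simp only: sum_subtractf sum_negf sum_distrib_left)
    then show ?thesis
      using sum.swap[of "\<lambda>i k. ((eb k \<lrcorner> ?S (eb i)) \<and>\<^sub>\<Lambda> (eb k \<lrcorner> eb i \<lrcorner> \<alpha>)) vs" ?I ?I]
      by (simp add: form_sum_apply del: iprod_apply)
  qed
  finally show "?L vs = ?R vs" by simp
qed

end

section \<open>Levi-Civita and characteristic connection in an adapted frame\<close>

lemma multilinear_2_linear:
  assumes "multilinear_form 2 g"
  shows "linear (\<lambda>u. g [u, v])" "linear (\<lambda>v. g [u, v])"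
proof -
  have "linear (\<lambda>w. g (vs[i := w]))" if "length vs = 2" "i < 2" for vs i
    using assms that unfolding multilinear_form_def by blast
  from this[of "[0, v]" 0] this[of "[u, 0]" 1]
  show "linear (\<lambda>u. g [u, v])" "linear (\<lambda>v. g [u, v])" by (simp_all add: One_nat_def)
qed

lemma linear_frame_map: "linear (frame_map f)"
  by (rule linearI)
    (simp_all add: frame_map_def inner_add_left scaleR_left_distrib sum.distrib scaleR_sum_right)

lemma frame_map_eb:
  assumes "i \<in> {1..8}"
  shows "frame_map f (eb i) = f i"
proof -
  have "frame_map f (eb i) = (\<Sum>k\<in>{1..8}. if i = k then f k else 0)"
    unfolding frame_map_def by (intro sum.cong) (use assms in \<open>auto simp: eb_inner_eb\<close>)
  then show ?thesis using assms by simp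
qed

lemma Lam_pullback:
  assumes \<alpha>: "\<alpha> \<in> Lam k" and L: "linear L"
  shows "pullback L \<alpha> \<in> Lam k"
proof -
  have "linear (\<lambda>v. pullback L \<alpha> (vs[i := v]))" if "length vs = k" "i < k" for vs i
    using linear_compose[OF L Lam_linear_update[OF \<alpha>, of i "map L vs"]] that
    by (simp add: pullback_def map_update o_def)
  moreover have "pullback L \<alpha> vs = 0" if "i < j" "j < length vs" "vs ! i = vs ! j" for vs i j
    using Lam_eq_zero[OF \<alpha>, of i j "map L vs"] that by (simp add: pullback_def)
  ultimately show ?thesis
    using Lam_length[OF \<alpha>] by (auto simp: Lam_def multilinear_form_def pullback_def)
qed

context
  fixes g :: form and f :: frame
  assumes g: "multilinear_form 2 g" and orth: "oriented_orthonormal g f"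
begin

lemma metric_frame_map: "g [frame_map f u, frame_map f v] = u \<bullet> v"
proof -
  note lin = multilinear_2_linear[OF g]
  have "g [frame_map f u, frame_map f v] =
      (\<Sum>i\<in>{1..8}. \<Sum>j\<in>{1..8}. (u \<bullet> eb i) * ((v \<bullet> eb j) * g [f i, f j]))"
    unfolding frame_map_def
    by (simp add: linear_sum[OF lin(1)] linear_scale[OF lin(1)] linear_sum[OF lin(2)]
        linear_scale[OF lin(2)] sum_distrib_left) (subst sum.swap, simp add: mult.left_commute)
  also have "\<dots> = (\<Sum>i\<in>{1..8}. \<Sum>j\<in>{1..8}. if i = j then (u \<bullet> eb i) * (v \<bullet> eb i) else 0)"
    using orth by (intro sum.cong) (auto simp: oriented_orthonormal_def)
  also have "\<dots> = u \<bullet> v" by (simp add: inner_eb_expansion[of u v])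
  finally show ?thesis .
qed

lemma bij_frame_map: "bij (frame_map f)"
proof -
  have "v = 0" if "frame_map f v = 0" for v
    using metric_frame_map[of v v] linear_0[OF multilinear_2_linear(1)[OF g]] that by simp
  then have "inj (frame_map f)" using linear_injective_0[OF linear_frame_map] by blast
  then show ?thesis
    using linear_injective_imp_surjective[OF linear_frame_map] by (simp add: bij_def)
qed

text \<open>Riesz representation in an orthonormal frame. It supplies existence and uniqueness for
  the definite descriptions that define both connections.\<close>

lemma metric_riesz:
  assumes \<phi>: "linear \<phi>"
  shows "(\<forall>z. g [w, z] = \<phi> z) \<longleftrightarrow> w = frame_map f (\<Sum>k\<in>{1..8}. \<phi> (f k) *\<^sub>R eb k)"
proof -
  let ?s = "\<Sum>k\<in>{1..8}. \<phi> (f k) *\<^sub>R eb k"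
  have \<phi>_eq: "\<phi> (frame_map f z) = ?s \<bullet> z" for z
    by (simp add: frame_map_def linear_sum[OF \<phi>] linear_scale[OF \<phi>] inner_sum_left
        inner_commute[of z] mult.commute)
  obtain w' where w': "w = frame_map f w'" using bij_frame_map by (metis bij_pointE)
  have "(\<forall>z. g [w, z] = \<phi> z) \<longleftrightarrow> (\<forall>z. g [w, frame_map f z] = \<phi> (frame_map f z))"
    using bij_frame_map by (metis bij_pointE)
  also have "\<dots> \<longleftrightarrow> w' = ?s"
    unfolding w' metric_frame_map \<phi>_eq by (rule vector_eq_rdot)
  also have "\<dots> \<longleftrightarrow> w = frame_map f ?s"
    unfolding w' using bij_frame_map by (simp add: bij_def inj_eq)
  finally show ?thesis .
qed

end

section \<open>Existence and uniqueness of the Levi-Civita connection\<close>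

lemma smooth_on_differentiable: "smooth_on S h \<Longrightarrow> x \<in> S \<Longrightarrow> h differentiable (at x)"
  unfolding smooth_on_def using k_smooth_on.simps(2) by blast

lemma frechet_derivative_add:
  "h differentiable (at x) \<Longrightarrow> h' differentiable (at x) \<Longrightarrow>
    frechet_derivative (\<lambda>y. h y + h' y) (at x) z = frechet_derivative h (at x) z + frechet_derivative h' (at x) z"
  by (subst frechet_derivative_at[symmetric, of "\<lambda>y. h y + h' y"])
    (auto intro!: has_derivative_add simp: frechet_derivative_works)

lemma frechet_derivative_scale:
  fixes h :: "_ \<Rightarrow> real"
  shows "h differentiable (at x) \<Longrightarrow>
    frechet_derivative (\<lambda>y. r * h y) (at x) z = r * frechet_derivative h (at x) z"
  by (subst frechet_derivative_at[symmetric, of "\<lambda>y. r * h y"])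
    (auto intro!: has_derivative_mult_right simp: frechet_derivative_works)

text \<open>Nothing is known about \<open>levi_civita\<close> before its description is shown to be
  satisfied uniquely; the witness \<open>K\<close> comes from the Koszul formula.\<close>

lemma levi_civita_properties:
  fixes G :: "vec8 \<Rightarrow> form"
  assumes S: "open S" "x \<in> S"
    and G: "\<And>y. y \<in> S \<Longrightarrow> multilinear_form 2 (G y)"
    and sym: "\<And>y u v. y \<in> S \<Longrightarrow> G y [u, v] = G y [v, u]"
    and smooth: "\<And>vs. smooth_on S (\<lambda>y. G y vs)"
    and orth: "oriented_orthonormal (G x) f"
  shows "bilinear (levi_civita G x)" "levi_civita G x u v = levi_civita G x v u"
proof -
  define D where "D z u v = frechet_derivative (\<lambda>y. G y [u, v]) (at x) z" for z u v
  have diff: "(\<lambda>y. G y [u, v]) differentiable (at x)" for u v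
    using smooth_on_differentiable[OF smooth S(2)] .
  \<comment> \<open>The algebraic properties of \<open>G y\<close> hold only for \<open>y\<close> in
    the open set \<open>S\<close>, so functions are compared there before their derivatives are
    equated.\<close>
  note transform = frechet_derivative_transform_within_open[OF diff S, unfolded fun_eq_iff, rule_format]
  have D1: "linear (\<lambda>z. D z u v)" for u v
    unfolding D_def by (rule linear_frechet_derivative[OF diff])
  have D_sym: "D z u v = D z v u" for z u v
    unfolding D_def by (rule transform) (rule sym)
  have D2: "linear (\<lambda>u. D z u v)" for z v
  proof (rule linearI)
    fix a b :: vec8 and r :: real
    have "D z (a + b) v = frechet_derivative (\<lambda>y. G y [a, v] + G y [b, v]) (at x) z"
      unfolding D_def by (rule transform) (use linear_add[OF multilinear_2_linear(1)[OF G]] in simp)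
    then show "D z (a + b) v = D z a v + D z b v"
      unfolding D_def by (simp add: frechet_derivative_add diff)
    have "D z (r *\<^sub>R a) v = frechet_derivative (\<lambda>y. r * G y [a, v]) (at x) z"
      unfolding D_def by (rule transform) (use linear_scale[OF multilinear_2_linear(1)[OF G]] in simp)
    then show "D z (r *\<^sub>R a) v = r *\<^sub>R D z a v"
      unfolding D_def by (simp add: frechet_derivative_scale diff)
  qed
  have D3: "linear (\<lambda>v. D z u v)" for z u
    using D2[of z u] D_sym[of z u] by simp
  note Gx = G[OF S(2)] and symx = sym[OF S(2)]
  note lin = multilinear_2_linear[OF Gx]
  \<comment> \<open>The Christoffel symbol of the first kind: constant coordinate fields commute, so
    the Koszul formula has no bracket terms.\<close>
  define \<kappa> where "\<kappa> u v w = (D u v w + D v u w - D w u v) / 2" for u v w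
  have \<kappa>: "linear (\<lambda>u. \<kappa> u v w)" "linear (\<lambda>v. \<kappa> u v w)" "linear (\<lambda>w. \<kappa> u v w)" for u v w
    by (rule linearI; simp add: \<kappa>_def linear_add[OF D1] linear_add[OF D2] linear_add[OF D3]
        linear_scale[OF D1] linear_scale[OF D2] linear_scale[OF D3] field_simps)+
  define K where "K u v = frame_map f (\<Sum>k\<in>{1..8}. \<kappa> u v (f k) *\<^sub>R eb k)" for u v
  have K: "G x [K u v, w] = \<kappa> u v w" for u v w
    using metric_riesz[OF Gx orth \<kappa>(3), of "K u v" u v] by (simp add: K_def)
  have K_unique: "w = K u v" if "\<And>z. G x [w, z] = \<kappa> u v z" for u v w
    using metric_riesz[OF Gx orth \<kappa>(3), of w u v] that by (simp add: K_def)
  let ?P = "\<lambda>\<Gamma>. bilinear \<Gamma> \<and> (\<forall>u v. \<Gamma> u v = \<Gamma> v u) \<and>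
     (\<forall>z u v. frechet_derivative (\<lambda>y. G y [u, v]) (at x) z = G x [\<Gamma> z u, v] + G x [u, \<Gamma> z v])"
  have "?P K"
  proof (intro conjI allI)
    show "bilinear K"
      unfolding bilinear_def
      by (intro conjI allI linearI)
        (simp_all add: K_def linear_add[OF \<kappa>(1)] linear_add[OF \<kappa>(2)] linear_scale[OF \<kappa>(1)]
          linear_scale[OF \<kappa>(2)] scaleR_left_distrib sum.distrib linear_add[OF linear_frame_map]
          linear_sum[OF linear_frame_map] linear_scale[OF linear_frame_map] scaleR_sum_right)
    show "K u v = K v u" for u v
      unfolding K_def by (simp add: \<kappa>_def D_sym[of _ u v] add.commute)
    show "frechet_derivative (\<lambda>y. G y [u, v]) (at x) z = G x [K z u, v] + G x [u, K z v]" for z u v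
      unfolding symx[of u] K D_def[symmetric] \<kappa>_def
      using D_sym[of z u v] D_sym[of u z v] D_sym[of v z u] by (simp add: field_simps)
  qed
  \<comment> \<open>Metric compatibility for the three choices of the differentiating vector,
    combined with symmetry of \<Gamma>, determines \<Gamma>.\<close>
  moreover have "\<Gamma> = K" if "?P \<Gamma>" for \<Gamma>
  proof (intro ext K_unique)
    fix u v z
    have "D z u v = G x [\<Gamma> z u, v] + G x [u, \<Gamma> z v]" and "\<Gamma> u v = \<Gamma> v u" for z u v
      using that unfolding D_def by blast+
    then show "G x [\<Gamma> u v, z] = \<kappa> u v z"
      unfolding \<kappa>_def using symx[of v "\<Gamma> u z"] symx[of u "\<Gamma> v z"] symx[of u "\<Gamma> z v"]
      by simp
  qed
  ultimately have "?P (levi_civita G x)"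
    unfolding levi_civita_def by (rule theI)
  then show "bilinear (levi_civita G x)" "levi_civita G x u v = levi_civita G x v u" by blast+
qed

section \<open>Parallel forms at one point of a chart\<close>

context
  fixes G :: "vec8 \<Rightarrow> form" and S :: "vec8 set" and x :: vec8 and f :: frame
    and R T\<^sub>x F\<^sub>x :: form
  assumes S: "open S" "x \<in> S"
    and G_multilinear: "\<forall>y\<in>S. multilinear_form 2 (G y)"
    and G_symmetric: "\<forall>y\<in>S. \<forall>u v. G y [u, v] = G y [v, u]"
    and smooth: "\<And>vs. smooth_on S (\<lambda>y. G y vs)"
    and adapted: "adapted_frame (G x) R f"
    and T: "in_frame f T\<^sub>x \<in> Lam 3"
    and F: "in_frame f F\<^sub>x \<in> hodge ` Lam4_8 + hodge ` Lam4_27"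
begin

lemmas metric_multilinear = G_multilinear[rule_format] and metric_symmetric = G_symmetric[rule_format]

lemma frame_orthonormal: "oriented_orthonormal (G x) f"
  using adapted by (simp add: adapted_frame_def)

lemma char_4_form_Lam: "in_frame f F\<^sub>x \<in> Lam 4"
  by (rule hodge_Lam4_Lam[OF F])

text \<open>\<open>frame_map f\<close> carries the inner product to the metric and pulls
  \<open>R\<close> back to \<open>rho0\<close>, so the defining equation of the connection becomes
  that of \<open>char_map\<close> in the model space.\<close>

lemma characteristic_connection_frame:
  "characteristic_connection G x f R T\<^sub>x F\<^sub>x (frame_map f u) (frame_map f v) =
    levi_civita G x (frame_map f u) (frame_map f v) + frame_map f (char_map (in_frame f T\<^sub>x) (in_frame f F\<^sub>x) u v)"
proof -
  note Gx = metric_multilinear[OF S(2)]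
  note bij = bij_frame_map[OF Gx frame_orthonormal]
  have inv: "inv (frame_map f) (frame_map f z) = z" for z using bij by (simp add: bij_def)
  let ?c = "levi_civita G x (frame_map f u) (frame_map f v)" and ?w = "levi_civita G x (frame_map f u) (frame_map f v) + frame_map f (char_map (in_frame f T\<^sub>x) (in_frame f F\<^sub>x) u v)"
  let ?\<psi> = "\<lambda>Z. G x [?c, Z] + 1 / 2 * T\<^sub>x [frame_map f u, frame_map f v, Z]
       + from_frame f (contr 2 (in_frame f (frame_map f u \<lrcorner> R)) (in_frame f F\<^sub>x)) [frame_map f v, Z]"
  have "in_frame f (frame_map f u \<lrcorner> R) = u \<lrcorner> in_frame f R"
    by (simp add: fun_eq_iff in_frame_def pullback_def)
  then have R: "in_frame f (frame_map f u \<lrcorner> R) = u \<lrcorner> rho0"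
    using adapted by (simp add: adapted_frame_def)
  have "G x [?w, frame_map f z] = ?\<psi> (frame_map f z)" for z
    unfolding R linear_add[OF multilinear_2_linear(1)[OF Gx]] metric_frame_map[OF Gx frame_orthonormal]
      inner_char_map[OF T char_4_form_Lam] char_form_apply[OF T char_4_form_Lam]
    by (simp add: from_frame_def in_frame_def pullback_def inv)
  then have eq: "G x [?w, Z] = ?\<psi> Z" for Z
    using bij by (metis bij_pointE)
  have "w = ?w" if "\<And>Z. G x [w, Z] = ?\<psi> Z" for w
  proof -
    note riesz = metric_riesz[OF Gx frame_orthonormal multilinear_2_linear(2)[OF Gx, of ?w]]
    show ?thesis using riesz[of w] riesz[of ?w] that eq by simp
  qed
  then show ?thesis
    unfolding characteristic_connection_def using eq by (intro the_equality) blast+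
qed

context
  fixes \<alpha> :: "vec8 \<Rightarrow> form" and n :: nat
  assumes \<alpha>: "\<alpha> x \<in> Lam n"
    and parallel: "\<And>u. cov_form (characteristic_connection G x f R T\<^sub>x F\<^sub>x) \<alpha> x u = 0"
begin

text \<open>The arguments stay constant in the coordinates of the chart, so no derivative of a frame
  field occurs.\<close>

definition "frame_derivative u ws = frechet_derivative (\<lambda>y. \<alpha> y (map (frame_map f) ws)) (at x) (frame_map f u)"

text \<open>The Christoffel symbols of the chart transported to the model space; unlike the
  connection form of a moving frame, they are symmetric in \<open>u\<close> and
  \<open>v\<close>.\<close>

definition "frame_levi_civita u v = inv (frame_map f) (levi_civita G x (frame_map f u) (frame_map f v))"

lemma frame_map_levi_civita: "frame_map f (frame_levi_civita u v) = levi_civita G x (frame_map f u) (frame_map f v)"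
  using bij_frame_map[OF metric_multilinear[OF S(2)] frame_orthonormal]
  by (simp add: frame_levi_civita_def bij_def surj_f_inv_f)

lemma frame_derivative_eq:
  "frame_derivative u ws = (\<Sum>l<length ws.
    in_frame f (\<alpha> x) (ws[l := frame_levi_civita u (ws ! l) + char_map (in_frame f T\<^sub>x) (in_frame f F\<^sub>x) u (ws ! l)]))"
proof -
  have "frame_derivative u ws = (\<Sum>l<length ws.
      \<alpha> x ((map (frame_map f) ws)[l := characteristic_connection G x f R T\<^sub>x F\<^sub>x (frame_map f u) (map (frame_map f) ws ! l)]))"
    using fun_cong[OF parallel, of "frame_map f u" "map (frame_map f) ws"] by (simp add: cov_form_def frame_derivative_def)
  also have "\<dots> = (\<Sum>l<length ws.
      in_frame f (\<alpha> x) (ws[l := frame_levi_civita u (ws ! l) + char_map (in_frame f T\<^sub>x) (in_frame f F\<^sub>x) u (ws ! l)]))"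
    by (intro sum.cong)
      (simp_all add: characteristic_connection_frame in_frame_def pullback_def map_update
        linear_add[OF linear_frame_map] frame_map_levi_civita)
  finally show ?thesis .
qed

lemma in_frame_Lam: "in_frame f (\<alpha> x) \<in> Lam n"
  unfolding in_frame_def by (rule Lam_pullback[OF \<alpha> linear_frame_map])

lemma in_frame_ext_d_parallel:
  "in_frame f (ext_d \<alpha> x) =
    (\<Sum>k\<in>{1..8}. (eb k \<lrcorner> (in_frame f T\<^sub>x)) \<and>\<^sub>\<Lambda> (eb k \<lrcorner> in_frame f (\<alpha> x)))
    - (\<Sum>k\<in>{1..8}. contr 2 (eb k \<lrcorner> rho0) (in_frame f F\<^sub>x) \<and>\<^sub>\<Lambda> (eb k \<lrcorner> in_frame f (\<alpha> x)))"
proof -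
  note lc = levi_civita_properties[OF S metric_multilinear metric_symmetric smooth frame_orthonormal]
  note bij = bij_frame_map[OF metric_multilinear[OF S(2)] frame_orthonormal]
  have inv: "linear (inv (frame_map f))"
    using inj_linear_imp_inv_linear[OF linear_frame_map] bij by (simp add: bij_def)
  have "in_frame f (ext_d \<alpha> x) =
      (\<lambda>vs. \<Sum>i<length vs. (- 1) ^ i * frame_derivative (vs ! i) (take i vs @ drop (Suc i) vs))"
    by (simp add: fun_eq_iff in_frame_def pullback_def ext_d_def frame_derivative_def take_map drop_map)
  also have "\<dots> = (\<Sum>k\<in>{1..8}. (eb k \<lrcorner> (in_frame f T\<^sub>x)) \<and>\<^sub>\<Lambda> (eb k \<lrcorner> in_frame f (\<alpha> x)))
    - (\<Sum>k\<in>{1..8}. contr 2 (eb k \<lrcorner> rho0) (in_frame f F\<^sub>x) \<and>\<^sub>\<Lambda> (eb k \<lrcorner> in_frame f (\<alpha> x)))"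
  proof (rule alternated_char_derivation[OF T char_4_form_Lam contr_rho0_cyclic[OF F] _ _ _ in_frame_Lam])
    show "linear (frame_levi_civita u)" for u
    proof -
      have "linear (levi_civita G x (frame_map f u))" using lc(1) by (simp add: bilinear_def)
      then have "linear (inv (frame_map f) \<circ> levi_civita G x (frame_map f u) \<circ> frame_map f)"
        by (intro linear_compose linear_frame_map inv)
      then show ?thesis by (simp add: frame_levi_civita_def[abs_def] o_def)
    qed
    show "linear (\<lambda>u. frame_levi_civita u v)" for v
    proof -
      have "linear (\<lambda>u. levi_civita G x u (frame_map f v))" using lc(1) by (simp add: bilinear_def)
      then have "linear (inv (frame_map f) \<circ> (\<lambda>u. levi_civita G x u (frame_map f v)) \<circ> frame_map f)"
        by (intro linear_compose linear_frame_map inv)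
      then show ?thesis by (simp add: frame_levi_civita_def[abs_def] o_def)
    qed
    show "frame_levi_civita u v = frame_levi_civita v u" for u v
      by (simp add: frame_levi_civita_def lc(2)[of "frame_map f u"])
  qed (rule frame_derivative_eq)
  finally show ?thesis .
qed

lemma in_frame_codiff_parallel:
  "in_frame f (codiff G f \<alpha> x) =
    - (3 \<cdot> contr 1 (contr 3 rho0 (in_frame f F\<^sub>x)) (in_frame f (\<alpha> x)))
      + (1 / 2) \<cdot> (\<Sum>i\<in>{1..8}. \<Sum>j\<in>{1..8}.
          (eb i \<lrcorner> eb j \<lrcorner> (in_frame f T\<^sub>x)) \<and>\<^sub>\<Lambda> (eb i \<lrcorner> eb j \<lrcorner> in_frame f (\<alpha> x)))
      + (\<Sum>i\<in>{1..8}. \<Sum>j\<in>{1..8}.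
          (eb i \<lrcorner> contr 2 (eb j \<lrcorner> rho0) (in_frame f F\<^sub>x)) \<and>\<^sub>\<Lambda> (eb i \<lrcorner> eb j \<lrcorner> in_frame f (\<alpha> x)))"
proof -
  let ?A = "in_frame f (\<alpha> x)"
  \<comment> \<open>The Levi-Civita terms in \<open>frame_derivative_eq\<close> are exactly those
    that \<open>cov_form\<close> subtracts, which leaves the action of
    \<open>char_map\<close>.\<close>
  have cov: "cov_form (levi_civita G x) \<alpha> x (frame_map f u) (map (frame_map f) ws) =
      (\<Sum>l<length ws. ?A (ws[l := char_map (in_frame f T\<^sub>x) (in_frame f F\<^sub>x) u (ws ! l)]))" for u ws
  proof -
    have "\<alpha> x ((map (frame_map f) ws)[l := levi_civita G x (frame_map f u) (map (frame_map f) ws ! l)]) =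
        ?A (ws[l := frame_levi_civita u (ws ! l)])" if "l < length ws" for l
      using that by (simp add: in_frame_def pullback_def map_update frame_map_levi_civita)
    moreover have "?A (ws[l := frame_levi_civita u (ws ! l) + char_map (in_frame f T\<^sub>x) (in_frame f F\<^sub>x) u (ws ! l)]) =
        ?A (ws[l := frame_levi_civita u (ws ! l)]) + ?A (ws[l := char_map (in_frame f T\<^sub>x) (in_frame f F\<^sub>x) u (ws ! l)])"
      if "l < length ws" for l
      by (rule linear_add[OF Lam_linear_update[OF in_frame_Lam that]])
    ultimately show ?thesis
      using frame_derivative_eq[of u ws]
      by (simp add: cov_form_def frame_derivative_def sum.distrib)
  qed
  have "in_frame f (codiff G f \<alpha> x) = (\<lambda>vs. - (\<Sum>i\<in>{1..8}. \<Sum>l<length (eb i # vs).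
      ?A ((eb i # vs)[l := char_map (in_frame f T\<^sub>x) (in_frame f F\<^sub>x) (eb i) ((eb i # vs) ! l)])))"
  proof
    fix vs
    have "in_frame f (codiff G f \<alpha> x) vs =
        - (\<Sum>i\<in>{1..8}. cov_form (levi_civita G x) \<alpha> x (f i) (f i # map (frame_map f) vs))"
      by (simp add: in_frame_def pullback_def codiff_def form_sum_apply)
    also have "\<dots> = - (\<Sum>i\<in>{1..8}. cov_form (levi_civita G x) \<alpha> x (frame_map f (eb i)) (map (frame_map f) (eb i # vs)))"
      by (simp add: frame_map_eb)
    finally show "in_frame f (codiff G f \<alpha> x) vs = - (\<Sum>i\<in>{1..8}. \<Sum>l<length (eb i # vs).
      ?A ((eb i # vs)[l := char_map (in_frame f T\<^sub>x) (in_frame f F\<^sub>x) (eb i) ((eb i # vs) ! l)]))"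
      unfolding cov .
  qed
  then show ?thesis
    unfolding contracted_char_derivation[OF T char_4_form_Lam in_frame_Lam] .
qed

end

end

theorem corollary5p2:
  fixes A :: "('a::{t2_space, second_countable_topology}) chart set"
    and g \<rho> Tc Fc :: "'a tfield"
  assumes "psu3_structure A g \<rho>"
    and "type_W1_to_W5 A g \<rho>"
    and "characteristic_forms A g \<rho> Tc Fc"
    and "characteristically_parallel A g \<rho> Tc Fc Tc"
    and "characteristically_parallel A g \<rho> Tc Fc Fc"
    and "c \<in> A" and "x \<in> chart_image c" and "adapted_frame (g c x) (\<rho> c x) f"
  shows "let T = in_frame f (Tc c x); F = in_frame f (Fc c x) in
    in_frame f (ext_d (Tc c) x) =
        (\<Sum>i\<in>{1..8}. (eb i \<lrcorner> T) \<and>\<^sub>\<Lambda> (eb i \<lrcorner> T))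
      - (\<Sum>i\<in>{1..8}. contr 2 (eb i \<lrcorner> rho0) F \<and>\<^sub>\<Lambda> (eb i \<lrcorner> T)) \<and>
    in_frame f (codiff (g c) f (Tc c) x) =
        - (3 \<cdot> contr 1 (contr 3 rho0 F) T)
      + (\<Sum>i\<in>{1..8}. \<Sum>j\<in>{1..8}.
           (eb i \<lrcorner> contr 2 (eb j \<lrcorner> rho0) F) \<and>\<^sub>\<Lambda> (eb i \<lrcorner> eb j \<lrcorner> T)) \<and>
    in_frame f (ext_d (Fc c) x) =
        (\<Sum>i\<in>{1..8}. (eb i \<lrcorner> T) \<and>\<^sub>\<Lambda> (eb i \<lrcorner> F))
      - (\<Sum>i\<in>{1..8}. contr 2 (eb i \<lrcorner> rho0) F \<and>\<^sub>\<Lambda> (eb i \<lrcorner> F)) \<and>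
    in_frame f (codiff (g c) f (Fc c) x) =
        - (3 \<cdot> contr 1 (contr 3 rho0 F) F)
      + (1 / 2) \<cdot> (\<Sum>i\<in>{1..8}. \<Sum>j\<in>{1..8}. (eb i \<lrcorner> eb j \<lrcorner> T) \<and>\<^sub>\<Lambda> (eb i \<lrcorner> eb j \<lrcorner> F))
      + (\<Sum>i\<in>{1..8}. \<Sum>j\<in>{1..8}.
           (eb i \<lrcorner> contr 2 (eb j \<lrcorner> rho0) F) \<and>\<^sub>\<Lambda> (eb i \<lrcorner> eb j \<lrcorner> F))"
proof -
  note psu3 = assms(1)[unfolded psu3_structure_def]
  note forms = assms(3)[unfolded characteristic_forms_def]
  let ?S = "chart_image c" and ?T = "in_frame f (Tc c x)"
  have S: "open ?S"
    using psu3 \<open>c \<in> A\<close> by (simp add: oriented_atlas_def)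
  have g: "\<forall>y\<in>?S. multilinear_form 2 (g c y)" "\<forall>y\<in>?S. \<forall>u v. g c y [u, v] = g c y [v, u]"
    using psu3 \<open>c \<in> A\<close> by (simp_all add: riemannian_metric_def tensor_field_def)
  have smooth: "smooth_on ?S (\<lambda>y. g c y vs)" for vs
    using psu3 \<open>c \<in> A\<close> by (simp add: riemannian_metric_def tensor_field_def)
  have T: "Tc c x \<in> Lam 3" and F: "Fc c x \<in> Lam 4"
    using forms assms(6,7) by (simp_all add: diff_form_def)
  have T': "?T \<in> Lam 3"
    unfolding in_frame_def by (rule Lam_pullback[OF T linear_frame_map])
  have F': "in_frame f (Fc c x) \<in> hodge ` Lam4_8 + hodge ` Lam4_27"
    using forms assms(6,7,8) by blast
  note formulas = in_frame_ext_d_parallel in_frame_codiff_parallel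
  note formulas = formulas[OF S assms(7) g smooth assms(8) T' F']
  have parT: "cov_form (characteristic_connection (g c) x f (\<rho> c x) (Tc c x) (Fc c x)) (Tc c) x u = 0"
    and parF: "cov_form (characteristic_connection (g c) x f (\<rho> c x) (Tc c x) (Fc c x)) (Fc c) x u = 0" for u
    using assms(4-8) unfolding characteristically_parallel_def by blast+
  \<comment> \<open>The general co-differential formula has a quadratic \<open>T\<close> term also
    for the form \<open>T\<close> itself; there it is a sum of squares of 1-forms and
    vanishes.\<close>
  have "eb i \<lrcorner> eb j \<lrcorner> ?T \<in> Lam 1" for i j
    by (intro Lam_2_iprod(1) Lam_3_iprod T')
  then have "(eb i \<lrcorner> eb j \<lrcorner> ?T) \<and>\<^sub>\<Lambda> (eb i \<lrcorner> eb j \<lrcorner> ?T) = 0" for i j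
    by (rule wedge_1_self)
  then have "(\<Sum>i\<in>{1..8}. \<Sum>j\<in>{1..8}. (eb i \<lrcorner> eb j \<lrcorner> ?T) \<and>\<^sub>\<Lambda> (eb i \<lrcorner> eb j \<lrcorner> ?T)) = 0"
    by (simp only: sum.neutral_const)
  moreover have "(1 / 2) \<cdot> (0 :: form) = 0" by (simp add: fun_eq_iff)
  ultimately show ?thesis
    using formulas(1)[OF T parT] formulas(1)[OF F parF]
      formulas(2)[OF T parT] formulas(2)[OF F parF]
    unfolding Let_def by (simp only: add_0_right simp_thms)
qed

end
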